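(* Let $M$ be a Riemannian manifold and consider on $M$ the stochastic differential equation $dx_t=X(x_t)\circ dB_t+A(x_t)\,dt$. Assume that it is strongly $1$-complete and that for each $t>0$ and each compact set $K\subset M$ there is a constant $\delta>0$ such that $$\sup_{x\in K}E|T_xF_t|^{1+\delta}<\infty .$$ Then for every $C^1$ function $f:M\to\mathbb R$ with both $f$ and $df$ bounded, $P_tf$ is $C^1$ and $$d(P_tf)=(\delta P_t)(df).$$
   Context: $B_t$ is an $\mathbb R^m$-valued Brownian motion on a filtered probability space satisfying the usual conditions, $X(x):\mathbb R^m\to T_xM$ is linear for each $x$, $A$ is a vector field, the coefficients $X,A$ are $C^2$, and $\circ$ denotes the Stratonovich integral. $F_t(x)$ is the maximal solution from $x$ with explosion time $\xi(x)$, taken in the version of a partial flow (almost surely $\{x:t<\xi(x,\omega)\}$ is open and $F_t(\cdot,\omega)$ is a $C^1$ diffeomorphism of it onto an open subset of $M$, continuously in $t$). $T_xF_t:T_xM\to T_{F_t(x)}M$ is the derivative flow; $v_t=T_xF_t(v)$ solves $Dv_t=\nabla X(v_t)\circ dB_t+\nabla A(v_t)\,dt$, $v_0=v$. For $K\subset M$ compact, $\xi^K=\inf_{x\in K}\xi(x)$. The equation is strongly $1$-complete if $\xi^K=\infty$ a.s. for every $K$ that is the image of a smooth singular $1$-simplex (smooth meaning extending smoothly over an open neighbourhood of the standard simplex). $P_tf(x)=E\big(f(F_t(x))\chi_{\{t<\xi(x)\}}\big)$, and for a $1$-form $\phi$ and $v\in T_xM$, $(\delta P_t)\phi(v)=E\big(\phi(T_xF_t(v))\chi_{\{t<\xi(x)\}}\big)$.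 *)

theory Defs
  imports "HOL-Probability.Probability"
begin

section \<open>Differentiability classes in Euclidean space\<close>

text \<open>Only used for open \<open>S\<close>.  In finite dimensions all directional values of the derivative
  being of class \<open>k\<close> is the same as the derivative itself being of class \<open>k\<close>.\<close>

primrec Ck_on :: "nat \<Rightarrow> 'a::euclidean_space set \<Rightarrow> ('a \<Rightarrow> 'b::real_normed_vector) \<Rightarrow> bool" where
  "Ck_on 0 S f \<longleftrightarrow> continuous_on S f"
| "Ck_on (Suc k) S f \<longleftrightarrow>
     (\<forall>x\<in>S. f differentiable (at x)) \<and> (\<forall>v. Ck_on k S (\<lambda>x. frechet_derivative f (at x) v))"

definition smooth_on :: "'a::euclidean_space set \<Rightarrow> ('a \<Rightarrow> 'b::real_normed_vector) \<Rightarrow> bool" where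
  "smooth_on S f \<longleftrightarrow> (\<forall>k. Ck_on k S f)"


section \<open>Smooth manifolds\<close>

text \<open>The manifold is the whole type \<open>'m\<close>, a second countable Hausdorff space, with a smooth (not
  necessarily maximal) atlas of charts valued in the Euclidean space \<open>'e\<close>.  A chart is a pair of
  its domain and a map that is relevant on the domain only.\<close>

type_synonym ('m, 'e) chart = "'m set \<times> ('m \<Rightarrow> 'e)"

abbreviation cdom :: "('m, 'e) chart \<Rightarrow> 'm set" where "cdom \<equiv> fst"
abbreviation cmap :: "('m, 'e) chart \<Rightarrow> 'm \<Rightarrow> 'e" where "cmap \<equiv> snd"

definition cinv :: "('m, 'e) chart \<Rightarrow> 'e \<Rightarrow> 'm" where
  "cinv c = inv_into (cdom c) (cmap c)"

definition smooth_atlas ::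
  "('m::{second_countable_topology,t2_space}, 'e::euclidean_space) chart set \<Rightarrow> bool" where
  "smooth_atlas \<A> \<longleftrightarrow>
     (\<Union>c\<in>\<A>. cdom c) = UNIV \<and>
     (\<forall>c\<in>\<A>. open (cdom c) \<and> open (cmap c ` cdom c) \<and>
        homeomorphism (cdom c) (cmap c ` cdom c) (cmap c) (cinv c)) \<and>
     (\<forall>c\<in>\<A>. \<forall>d\<in>\<A>. smooth_on (cmap c ` (cdom c \<inter> cdom d)) (cmap d \<circ> cinv c))"

definition chart_at :: "('m, 'e) chart set \<Rightarrow> 'm \<Rightarrow> ('m, 'e) chart" where
  "chart_at \<A> x = (SOME c. c \<in> \<A> \<and> x \<in> cdom c)"

definition Ck_fun ::
  "('m::topological_space, 'e::euclidean_space) chart set \<Rightarrow> nat \<Rightarrow> ('m \<Rightarrow> real) \<Rightarrow> bool" where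
  "Ck_fun \<A> k f \<longleftrightarrow> (\<forall>c\<in>\<A>. Ck_on k (cmap c ` cdom c) (f \<circ> cinv c))"

definition smooth_fun ::
  "('m::topological_space, 'e::euclidean_space) chart set \<Rightarrow> ('m \<Rightarrow> real) \<Rightarrow> bool" where
  "smooth_fun \<A> f \<longleftrightarrow> (\<forall>k. Ck_fun \<A> k f)"

text \<open>\<open>C\<^sup>k\<close> maps from an open subset \<open>W\<close> of \<open>M\<close> to \<open>M\<close>; continuity makes the sets on which the
  coordinate expressions are considered open.\<close>

definition Ck_map_on ::
  "('m::topological_space, 'e::euclidean_space) chart set \<Rightarrow> nat \<Rightarrow> 'm set \<Rightarrow> ('m \<Rightarrow> 'm) \<Rightarrow> bool" where
  "Ck_map_on \<A> k W h \<longleftrightarrow> continuous_on W h \<and>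
     (\<forall>c\<in>\<A>. \<forall>d\<in>\<A>. Ck_on k (cmap c ` (cdom c \<inter> W \<inter> h -` cdom d)) (cmap d \<circ> h \<circ> cinv c))"

text \<open>A tangent vector at \<open>x\<close> is the family of its components in all charts around \<open>x\<close>, which
  transform by the derivatives of the coordinate changes; the entries for the other charts are
  set to \<open>0\<close>.  The vector space operations are componentwise.\<close>

type_synonym ('m, 'e) tvec = "('m, 'e) chart \<Rightarrow> 'e"

definition tangent_space ::
  "('m, 'e::euclidean_space) chart set \<Rightarrow> 'm \<Rightarrow> ('m, 'e) tvec set" where
  "tangent_space \<A> x =
     {v. (\<forall>c\<in>\<A>. \<forall>d\<in>\<A>. x \<in> cdom c \<inter> cdom d \<longrightarrow>
            v d = frechet_derivative (cmap d \<circ> cinv c) (at (cmap c x)) (v c)) \<and>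
         (\<forall>c. \<not> (c \<in> \<A> \<and> x \<in> cdom c) \<longrightarrow> v c = 0)}"

text \<open>The tangent vector at \<open>x\<close> whose component in the chart \<open>c\<close> around \<open>x\<close> is \<open>e\<close>: a linear
  isomorphism from \<open>'e\<close> onto the tangent space.\<close>

definition tvec_of ::
  "('m, 'e::euclidean_space) chart set \<Rightarrow> ('m, 'e) chart \<Rightarrow> 'm \<Rightarrow> 'e \<Rightarrow> ('m, 'e) tvec" where
  "tvec_of \<A> c x e =
     (\<lambda>d. if d \<in> \<A> \<and> x \<in> cdom d then frechet_derivative (cmap d \<circ> cinv c) (at (cmap c x)) e else 0)"

definition differential ::
  "('m, 'e::euclidean_space) chart set \<Rightarrow> ('m \<Rightarrow> real) \<Rightarrow> 'm \<Rightarrow> ('m, 'e) tvec \<Rightarrow> real" where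
  "differential \<A> f x v =
     (let c = chart_at \<A> x in frechet_derivative (f \<circ> cinv c) (at (cmap c x)) (v c))"

definition tangent_map ::
  "('m, 'e::euclidean_space) chart set \<Rightarrow> ('m \<Rightarrow> 'm) \<Rightarrow> 'm \<Rightarrow> ('m, 'e) tvec \<Rightarrow> ('m, 'e) tvec" where
  "tangent_map \<A> h x v =
     (\<lambda>d. if d \<in> \<A> \<and> h x \<in> cdom d
          then (let c = chart_at \<A> x in
                frechet_derivative (cmap d \<circ> h \<circ> cinv c) (at (cmap c x)) (v c))
          else 0)"

definition Ck_vector_field ::
  "('m::topological_space, 'e::euclidean_space) chart set \<Rightarrow> nat \<Rightarrow> ('m \<Rightarrow> ('m, 'e) tvec) \<Rightarrow> bool" where
  "Ck_vector_field \<A> k V \<longleftrightarrow>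
     (\<forall>x. V x \<in> tangent_space \<A> x) \<and>
     (\<forall>c\<in>\<A>. Ck_on k (cmap c ` cdom c) (\<lambda>y. V (cinv c y) c))"


section \<open>Riemannian metrics\<close>

definition riemannian_manifold ::
  "('m::{second_countable_topology,t2_space}, 'e::euclidean_space) chart set \<Rightarrow>
   ('m \<Rightarrow> ('m, 'e) tvec \<Rightarrow> ('m, 'e) tvec \<Rightarrow> real) \<Rightarrow> bool" where
  "riemannian_manifold \<A> g \<longleftrightarrow> smooth_atlas \<A> \<and>
     (\<forall>c\<in>\<A>. \<forall>x\<in>cdom c. bilinear (\<lambda>a b. g x (tvec_of \<A> c x a) (tvec_of \<A> c x b))) \<and>
     (\<forall>x. \<forall>u\<in>tangent_space \<A> x. \<forall>v\<in>tangent_space \<A> x. g x u v = g x v u) \<and>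
     (\<forall>x. \<forall>v\<in>tangent_space \<A> x. v \<noteq> (\<lambda>c. 0) \<longrightarrow> g x v v > 0) \<and>
     (\<forall>c\<in>\<A>. \<forall>a b. smooth_on (cmap c ` cdom c)
        (\<lambda>y. g (cinv c y) (tvec_of \<A> c (cinv c y) a) (tvec_of \<A> c (cinv c y) b)))"

definition tnorm ::
  "('m \<Rightarrow> ('m, 'e) tvec \<Rightarrow> ('m, 'e) tvec \<Rightarrow> real) \<Rightarrow> 'm \<Rightarrow> ('m, 'e) tvec \<Rightarrow> real" where
  "tnorm g x v = sqrt (g x v v)"

definition tangent_opnorm ::
  "('m, 'e::euclidean_space) chart set \<Rightarrow> ('m \<Rightarrow> ('m, 'e) tvec \<Rightarrow> ('m, 'e) tvec \<Rightarrow> real) \<Rightarrow>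
   'm \<Rightarrow> 'm \<Rightarrow> (('m, 'e) tvec \<Rightarrow> ('m, 'e) tvec) \<Rightarrow> real" where
  "tangent_opnorm \<A> g x y L = (SUP v\<in>{v \<in> tangent_space \<A> x. tnorm g x v \<le> 1}. tnorm g y (L v))"

definition bounded_one_form ::
  "('m, 'e::euclidean_space) chart set \<Rightarrow> ('m \<Rightarrow> ('m, 'e) tvec \<Rightarrow> ('m, 'e) tvec \<Rightarrow> real) \<Rightarrow>
   ('m \<Rightarrow> ('m, 'e) tvec \<Rightarrow> real) \<Rightarrow> bool" where
  "bounded_one_form \<A> g \<phi> \<longleftrightarrow> (\<exists>C. \<forall>x. \<forall>v\<in>tangent_space \<A> x. \<bar>\<phi> x v\<bar> \<le> C * tnorm g x v)"


section \<open>Filtered probability spaces and Brownian motion\<close>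

text \<open>Filtrations are indexed by \<open>[0,\<infinity>]\<close>, so that \<^const>\<open>stopping_time\<close> covers stopping times
  with values in \<open>[0,\<infinity>]\<close>; the \<open>\<sigma>\<close>-algebra with index \<open>\<infinity>\<close> plays no role.\<close>

definition usual_filtered_space :: "'w measure \<Rightarrow> (ennreal \<Rightarrow> 'w measure) \<Rightarrow> bool" where
  "usual_filtered_space P \<F> \<longleftrightarrow>
     prob_space P \<and> complete_measure P \<and> filtration (space P) \<F> \<and>
     (\<forall>t. sets (\<F> t) \<subseteq> sets P) \<and> null_sets P \<subseteq> sets (\<F> 0) \<and>
     (\<forall>t<\<infinity>. sets (\<F> t) = (\<Inter>s\<in>{t<..}. sets (\<F> s)))"

definition brownian_motion ::
  "'w measure \<Rightarrow> (ennreal \<Rightarrow> 'w measure) \<Rightarrow> (real \<Rightarrow> 'w \<Rightarrow> 'b::euclidean_space) \<Rightarrow> bool" where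
  "brownian_motion P \<F> B \<longleftrightarrow>
     (AE \<omega> in P. B 0 \<omega> = 0) \<and>
     (AE \<omega> in P. continuous_on {0..} (\<lambda>t. B t \<omega>)) \<and>
     (\<forall>t\<ge>0. B t \<in> borel_measurable (\<F> (ennreal t))) \<and>
     (\<forall>s\<ge>0. \<forall>t>s.
        prob_space.indep_set P (sets (\<F> (ennreal s)))
          {(\<lambda>\<omega>. B t \<omega> - B s \<omega>) -` S \<inter> space P |S. S \<in> sets borel} \<and>
        distributed P lborel (\<lambda>\<omega>. B t \<omega> - B s \<omega>)
          (\<lambda>z. ennreal (\<Prod>b\<in>Basis. normal_density 0 (sqrt (t - s)) (z \<bullet> b))))"


section \<open>Stratonovich integrals and stochastic differential equations\<close>

text \<open>\<open>I\<close> is a version of the Stratonovich integral \<open>\<integral>\<^sub>0\<^sup>t Y \<circ> dZ\<close>: the limit in probability of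
  the trapezoidal sums over partitions \<open>0 = p 0 \<le> \<dots> \<le> p N = t\<close> as the mesh tends to \<open>0\<close>.\<close>

definition stratonovich_integral ::
  "'w measure \<Rightarrow> (real \<Rightarrow> 'w \<Rightarrow> real) \<Rightarrow> (real \<Rightarrow> 'w \<Rightarrow> real) \<Rightarrow> real \<Rightarrow> ('w \<Rightarrow> real) \<Rightarrow> bool" where
  "stratonovich_integral P Y Z t I \<longleftrightarrow>
     (\<forall>s\<in>{0..t}. Y s \<in> borel_measurable P \<and> Z s \<in> borel_measurable P) \<and>
     I \<in> borel_measurable P \<and>
     (\<forall>\<epsilon>>0. \<forall>\<eta>>0. \<exists>\<delta>>0. \<forall>N p.
        p 0 = 0 \<and> p N = t \<and> (\<forall>i<N. p i \<le> p (Suc i) \<and> p (Suc i) - p i < \<delta>) \<longrightarrow>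
        measure P {\<omega> \<in> space P.
          \<bar>(\<Sum>i<N. (Y (p i) \<omega> + Y (p (Suc i)) \<omega>) / 2 * (Z (p (Suc i)) \<omega> - Z (p i) \<omega>)) - I \<omega>\<bar> > \<epsilon>} < \<eta>)"

definition stop_at :: "('w \<Rightarrow> ennreal) \<Rightarrow> real \<Rightarrow> 'w \<Rightarrow> real" where
  "stop_at \<tau> t \<omega> = enn2real (min (ennreal t) (\<tau> \<omega>))"

text \<open>Continuous semimartingales: sum of a continuous local martingale and a continuous adapted
  process of locally bounded variation.\<close>

definition continuous_adapted ::
  "'w measure \<Rightarrow> (ennreal \<Rightarrow> 'w measure) \<Rightarrow> (real \<Rightarrow> 'w \<Rightarrow> real) \<Rightarrow> bool" where
  "continuous_adapted P \<F> Y \<longleftrightarrow>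
     (\<forall>t\<ge>0. Y t \<in> borel_measurable (\<F> (ennreal t))) \<and>
     (AE \<omega> in P. continuous_on {0..} (\<lambda>t. Y t \<omega>))"

definition martingale ::
  "'w measure \<Rightarrow> (ennreal \<Rightarrow> 'w measure) \<Rightarrow> (real \<Rightarrow> 'w \<Rightarrow> real) \<Rightarrow> bool" where
  "martingale P \<F> Y \<longleftrightarrow>
     (\<forall>t\<ge>0. Y t \<in> borel_measurable (\<F> (ennreal t)) \<and> integrable P (Y t)) \<and>
     (\<forall>s\<ge>0. \<forall>t\<ge>s. \<forall>S\<in>sets (\<F> (ennreal s)). (LINT \<omega>:S|P. Y t \<omega>) = (LINT \<omega>:S|P. Y s \<omega>))"

definition continuous_local_martingale ::
  "'w measure \<Rightarrow> (ennreal \<Rightarrow> 'w measure) \<Rightarrow> (real \<Rightarrow> 'w \<Rightarrow> real) \<Rightarrow> bool" where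
  "continuous_local_martingale P \<F> Y \<longleftrightarrow> continuous_adapted P \<F> Y \<and>
     (\<exists>\<tau> :: nat \<Rightarrow> 'w \<Rightarrow> ennreal. (\<forall>n. stopping_time \<F> (\<tau> n)) \<and>
        (AE \<omega> in P. incseq (\<lambda>n. \<tau> n \<omega>) \<and> (SUP n. \<tau> n \<omega>) = \<infinity>) \<and>
        (\<forall>n. martingale P \<F> (\<lambda>t \<omega>. Y (stop_at (\<tau> n) t \<omega>) \<omega> - Y 0 \<omega>)))"

definition continuous_bv_process ::
  "'w measure \<Rightarrow> (ennreal \<Rightarrow> 'w measure) \<Rightarrow> (real \<Rightarrow> 'w \<Rightarrow> real) \<Rightarrow> bool" where
  "continuous_bv_process P \<F> Y \<longleftrightarrow> continuous_adapted P \<F> Y \<and>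
     (AE \<omega> in P. \<forall>T\<ge>0. \<exists>C. \<forall>N p. p 0 = 0 \<and> p N = T \<and> (\<forall>i<N. p i \<le> p (Suc i)) \<longrightarrow>
        (\<Sum>i<N. \<bar>Y (p (Suc i)) \<omega> - Y (p i) \<omega>\<bar>) \<le> C)"

definition continuous_semimartingale ::
  "'w measure \<Rightarrow> (ennreal \<Rightarrow> 'w measure) \<Rightarrow> (real \<Rightarrow> 'w \<Rightarrow> real) \<Rightarrow> bool" where
  "continuous_semimartingale P \<F> Y \<longleftrightarrow>
     (\<exists>N V. continuous_local_martingale P \<F> N \<and> continuous_bv_process P \<F> V \<and>
        (\<forall>t\<ge>0. \<forall>\<omega>\<in>space P. Y t \<omega> = N t \<omega> + V t \<omega>))"

text \<open>The equation \<open>dx\<^sub>t = X(x\<^sub>t) \<circ> dB\<^sub>t + A(x\<^sub>t) dt\<close> up to the stopping time \<open>\<tau>\<close>, tested on all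
  smooth functions \<open>h\<close>:
  \<open>h(x\<^bsub>t\<and>\<tau>\<^esub>) = h(x\<^sub>0) + \<Sum>\<^sub>j \<integral>\<^sub>0\<^sup>t\<^sup>\<and>\<^sup>\<tau> dh(X(x\<^sub>s) e\<^sub>j) \<circ> dB\<^sup>j\<^sub>s + \<integral>\<^sub>0\<^sup>t\<^sup>\<and>\<^sup>\<tau> dh(A(x\<^sub>s)) ds\<close>,
  with \<open>(e\<^sub>j)\<close> the standard basis.  The integral up to \<open>t \<and> \<tau>\<close> is that of the stopped processes.
  The stopped process is an \<open>M\<close>-valued semimartingale: its compositions with smooth functions are
  semimartingales.\<close>

definition solves_until ::
  "('m::topological_space, 'e::euclidean_space) chart set \<Rightarrow> 'w measure \<Rightarrow> (ennreal \<Rightarrow> 'w measure) \<Rightarrow>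
   (real \<Rightarrow> 'w \<Rightarrow> 'b::euclidean_space) \<Rightarrow> ('m \<Rightarrow> 'b \<Rightarrow> ('m, 'e) tvec) \<Rightarrow> ('m \<Rightarrow> ('m, 'e) tvec) \<Rightarrow>
   ('w \<Rightarrow> ennreal) \<Rightarrow> 'm \<Rightarrow> (real \<Rightarrow> 'w \<Rightarrow> 'm) \<Rightarrow> bool" where
  "solves_until \<A> P \<F> B X A \<tau> x0 x \<longleftrightarrow>
     (\<forall>h. smooth_fun \<A> h \<longrightarrow>
      continuous_semimartingale P \<F> (\<lambda>s \<omega>. h (x (stop_at \<tau> s \<omega>) \<omega>)) \<and>
      (\<forall>t\<ge>0. \<exists>I.
        (\<forall>j\<in>Basis. stratonovich_integral P
           (\<lambda>s \<omega>. let y = x (stop_at \<tau> s \<omega>) \<omega> in differential \<A> h y (X y j))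
           (\<lambda>s \<omega>. B (stop_at \<tau> s \<omega>) \<omega> \<bullet> j) t (I j)) \<and>
        (AE \<omega> in P. h (x (stop_at \<tau> t \<omega>) \<omega>) = h x0 + (\<Sum>j\<in>Basis. I j \<omega>) +
           (LBINT s:{0..stop_at \<tau> t \<omega>}. differential \<A> h (x s \<omega>) (A (x s \<omega>))))))"

text \<open>Solutions from \<open>x0\<close> on \<open>[0,\<zeta>)\<close>, with \<open>\<zeta>\<close> a stopping time announced by stopping times
  \<open>\<tau> n < \<zeta>\<close>; the values of \<open>x\<close> from \<open>\<zeta>\<close> on are irrelevant.\<close>

definition sde_solution ::
  "('m::topological_space, 'e::euclidean_space) chart set \<Rightarrow> 'w measure \<Rightarrow> (ennreal \<Rightarrow> 'w measure) \<Rightarrow>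
   (real \<Rightarrow> 'w \<Rightarrow> 'b::euclidean_space) \<Rightarrow> ('m \<Rightarrow> 'b \<Rightarrow> ('m, 'e) tvec) \<Rightarrow> ('m \<Rightarrow> ('m, 'e) tvec) \<Rightarrow>
   'm \<Rightarrow> (real \<Rightarrow> 'w \<Rightarrow> 'm) \<Rightarrow> ('w \<Rightarrow> ennreal) \<Rightarrow> bool" where
  "sde_solution \<A> P \<F> B X A x0 x \<zeta> \<longleftrightarrow>
     stopping_time \<F> \<zeta> \<and>
     (\<forall>t\<ge>0. x t \<in> borel_measurable (restrict_space (\<F> (ennreal t)) {\<omega> \<in> space P. ennreal t < \<zeta> \<omega>})) \<and>
     (AE \<omega> in P. x 0 \<omega> = x0) \<and>
     (AE \<omega> in P. continuous_on {t. 0 \<le> t \<and> ennreal t < \<zeta> \<omega>} (\<lambda>t. x t \<omega>)) \<and>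
     (\<exists>\<tau> :: nat \<Rightarrow> 'w \<Rightarrow> ennreal. (\<forall>n. stopping_time \<F> (\<tau> n)) \<and>
        (AE \<omega> in P. incseq (\<lambda>n. \<tau> n \<omega>) \<and> (\<forall>n. \<tau> n \<omega> < \<zeta> \<omega>) \<and> (SUP n. \<tau> n \<omega>) = \<zeta> \<omega>) \<and>
        (\<forall>n. solves_until \<A> P \<F> B X A (\<tau> n) x0 x))"

text \<open>Maximal: every solution from the same point is, almost surely, a restriction of this one.\<close>

definition maximal_solution ::
  "('m::topological_space, 'e::euclidean_space) chart set \<Rightarrow> 'w measure \<Rightarrow> (ennreal \<Rightarrow> 'w measure) \<Rightarrow>
   (real \<Rightarrow> 'w \<Rightarrow> 'b::euclidean_space) \<Rightarrow> ('m \<Rightarrow> 'b \<Rightarrow> ('m, 'e) tvec) \<Rightarrow> ('m \<Rightarrow> ('m, 'e) tvec) \<Rightarrow>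
   'm \<Rightarrow> (real \<Rightarrow> 'w \<Rightarrow> 'm) \<Rightarrow> ('w \<Rightarrow> ennreal) \<Rightarrow> bool" where
  "maximal_solution \<A> P \<F> B X A x0 x \<zeta> \<longleftrightarrow>
     sde_solution \<A> P \<F> B X A x0 x \<zeta> \<and>
     (\<forall>y \<eta>. sde_solution \<A> P \<F> B X A x0 y \<eta> \<longrightarrow>
        (AE \<omega> in P. \<eta> \<omega> \<le> \<zeta> \<omega> \<and> (\<forall>t\<ge>0. ennreal t < \<eta> \<omega> \<longrightarrow> y t \<omega> = x t \<omega>)))"


section \<open>Partial flows, strong 1-completeness and the semigroups\<close>

definition flow_domain :: "('m \<Rightarrow> 'w \<Rightarrow> ennreal) \<Rightarrow> real \<Rightarrow> 'w \<Rightarrow> 'm set" where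
  "flow_domain \<xi> t \<omega> = {x. ennreal t < \<xi> x \<omega>}"

definition C1_diffeo_onto_open ::
  "('m::topological_space, 'e::euclidean_space) chart set \<Rightarrow> 'm set \<Rightarrow> ('m \<Rightarrow> 'm) \<Rightarrow> bool" where
  "C1_diffeo_onto_open \<A> W h \<longleftrightarrow>
     Ck_map_on \<A> 1 W h \<and> inj_on h W \<and> open (h ` W) \<and> Ck_map_on \<A> 1 (h ` W) (inv_into W h)"

text \<open>The last two conjuncts say that \<open>s \<mapsto> F\<^sub>s\<close> is continuous from \<open>[0,t]\<close> into the \<open>C\<^sup>1\<close> maps on
  the open set \<open>flow_domain \<xi> t \<omega>\<close> with the topology of locally uniform convergence of maps and
  derivatives: this is joint continuity in time and space of \<open>F\<close> and its first derivatives.\<close>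

definition partial_flow ::
  "('m::topological_space, 'e::euclidean_space) chart set \<Rightarrow> 'w measure \<Rightarrow>
   (real \<Rightarrow> 'm \<Rightarrow> 'w \<Rightarrow> 'm) \<Rightarrow> ('m \<Rightarrow> 'w \<Rightarrow> ennreal) \<Rightarrow> bool" where
  "partial_flow \<A> P F \<xi> \<longleftrightarrow> (AE \<omega> in P.
     (\<forall>t\<ge>0. open (flow_domain \<xi> t \<omega>) \<and>
        C1_diffeo_onto_open \<A> (flow_domain \<xi> t \<omega>) (\<lambda>x. F t x \<omega>)) \<and>
     continuous_on {(t, x). 0 \<le> t \<and> x \<in> flow_domain \<xi> t \<omega>} (\<lambda>(t, x). F t x \<omega>) \<and>
     (\<forall>c\<in>\<A>. \<forall>d\<in>\<A>. \<forall>e. continuous_on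
        {(t, y). 0 \<le> t \<and> y \<in> cmap c ` (cdom c \<inter> flow_domain \<xi> t \<omega>) \<and> F t (cinv c y) \<omega> \<in> cdom d}
        (\<lambda>(t, y). frechet_derivative (cmap d \<circ> (\<lambda>x. F t x \<omega>) \<circ> cinv c) (at y) e)))"

text \<open>The standard 1-simplex is \<open>[0,1]\<close>; \<open>\<sigma>\<close> is the smooth extension to a neighbourhood.\<close>

definition smooth_1_simplex ::
  "('m::topological_space, 'e::euclidean_space) chart set \<Rightarrow> (real \<Rightarrow> 'm) \<Rightarrow> bool" where
  "smooth_1_simplex \<A> \<sigma> \<longleftrightarrow> (\<exists>U. open U \<and> {0..1} \<subseteq> U \<and> continuous_on U \<sigma> \<and>
     (\<forall>c\<in>\<A>. smooth_on (U \<inter> \<sigma> -` cdom c) (cmap c \<circ> \<sigma>)))"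

definition explosion_time_on :: "('m \<Rightarrow> 'w \<Rightarrow> ennreal) \<Rightarrow> 'm set \<Rightarrow> 'w \<Rightarrow> ennreal" where
  "explosion_time_on \<xi> K \<omega> = (INF x\<in>K. \<xi> x \<omega>)"

definition strongly_1_complete ::
  "('m::topological_space, 'e::euclidean_space) chart set \<Rightarrow> 'w measure \<Rightarrow> ('m \<Rightarrow> 'w \<Rightarrow> ennreal) \<Rightarrow> bool" where
  "strongly_1_complete \<A> P \<xi> \<longleftrightarrow>
     (\<forall>\<sigma>. smooth_1_simplex \<A> \<sigma> \<longrightarrow> (AE \<omega> in P. explosion_time_on \<xi> (\<sigma> ` {0..1}) \<omega> = \<infinity>))"

definition diffusion_semigroup ::
  "'w measure \<Rightarrow> (real \<Rightarrow> 'm \<Rightarrow> 'w \<Rightarrow> 'm) \<Rightarrow> ('m \<Rightarrow> 'w \<Rightarrow> ennreal) \<Rightarrow> real \<Rightarrow> ('m \<Rightarrow> real) \<Rightarrow> 'm \<Rightarrow> real" where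
  "diffusion_semigroup P F \<xi> t f x =
     (LINT \<omega>|P. f (F t x \<omega>) * indicator {\<omega>. ennreal t < \<xi> x \<omega>} \<omega>)"

definition delta_integrand ::
  "('m, 'e::euclidean_space) chart set \<Rightarrow> (real \<Rightarrow> 'm \<Rightarrow> 'w \<Rightarrow> 'm) \<Rightarrow> ('m \<Rightarrow> 'w \<Rightarrow> ennreal) \<Rightarrow> real \<Rightarrow>
   ('m \<Rightarrow> ('m, 'e) tvec \<Rightarrow> real) \<Rightarrow> 'm \<Rightarrow> ('m, 'e) tvec \<Rightarrow> 'w \<Rightarrow> real" where
  "delta_integrand \<A> F \<xi> t \<phi> x v \<omega> =
     \<phi> (F t x \<omega>) (tangent_map \<A> (\<lambda>y. F t y \<omega>) x v) * indicator {\<omega>. ennreal t < \<xi> x \<omega>} \<omega>"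

definition delta_semigroup ::
  "('m, 'e::euclidean_space) chart set \<Rightarrow> 'w measure \<Rightarrow> (real \<Rightarrow> 'm \<Rightarrow> 'w \<Rightarrow> 'm) \<Rightarrow>
   ('m \<Rightarrow> 'w \<Rightarrow> ennreal) \<Rightarrow> real \<Rightarrow> ('m \<Rightarrow> ('m, 'e) tvec \<Rightarrow> real) \<Rightarrow> 'm \<Rightarrow> ('m, 'e) tvec \<Rightarrow> real" where
  "delta_semigroup \<A> P F \<xi> t \<phi> x v = (LINT \<omega>|P. delta_integrand \<A> F \<xi> t \<phi> x v \<omega>)"

text \<open>\<open>E |T\<^sub>xF\<^sub>t|\<^sup>q\<close>, with the operator norm of \<open>T\<^sub>xF\<^sub>t\<close>, over the event \<open>t < \<xi>(x)\<close> on which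
  \<open>T\<^sub>xF\<^sub>t\<close> exists.\<close>

definition flow_moment ::
  "('m, 'e::euclidean_space) chart set \<Rightarrow> ('m \<Rightarrow> ('m, 'e) tvec \<Rightarrow> ('m, 'e) tvec \<Rightarrow> real) \<Rightarrow> 'w measure \<Rightarrow>
   (real \<Rightarrow> 'm \<Rightarrow> 'w \<Rightarrow> 'm) \<Rightarrow> ('m \<Rightarrow> 'w \<Rightarrow> ennreal) \<Rightarrow> real \<Rightarrow> real \<Rightarrow> 'm \<Rightarrow> ennreal" where
  "flow_moment \<A> g P F \<xi> q t x =
     (\<integral>\<^sup>+\<omega>. ennreal (tangent_opnorm \<A> g x (F t x \<omega>) (tangent_map \<A> (\<lambda>y. F t y \<omega>) x) powr q)
        * indicator {\<omega>. ennreal t < \<xi> x \<omega>} \<omega> \<partial>P)"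

end

theory Submission
  imports Defs
begin

text \<open>In a chart, strong 1-completeness applied to straight segments makes the random function
  \<open>y \<mapsto> f(F\<^sub>t(y))\<close> almost surely \<open>C\<^sup>1\<close> near any given segment, with derivative \<open>df(TF\<^sub>t)\<close>.  This
  derivative is bounded by a multiple of \<open>|TF\<^sub>t|\<close>, so by the moment assumption it is uniformly
  integrable, locally uniformly in \<open>y\<close>; hence its expectation is continuous in \<open>y\<close>.  Integrating
  along segments and exchanging the integrals identifies that expectation as the derivative
  of \<open>P\<^sub>tf\<close>.\<close>

section \<open>Functions of class C1\<close>

text \<open>Differentiating under the expectation directly would need a bound on difference
  quotients over one neighbourhood of a point that serves all \<omega>. Strong 1-completeness gives
  no such neighbourhood: it controls one segment at a time, with a null set that depends on the
  segment and an open set around it that depends on \<omega>. So the fundamental theorem of calculus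
  is applied pathwise on one fixed segment, and the segment varies only afterwards, inside
  deterministic expectations whose continuity is already known. The exponent 1 + \<delta> matters
  because bounded first moments alone do not let expectations pass to almost sure limits. Moments
  are assumed for positive times only; at time 0 the flow is the identity, and the derivative is
  bounded on compact sets by continuity.\<close>

lemma Ck_on_1:
  "Ck_on 1 S f \<longleftrightarrow> (\<forall>x\<in>S. f differentiable (at x)) \<and>
     (\<forall>v. continuous_on S (\<lambda>x. frechet_derivative f (at x) v))"
  by (simp add: One_nat_def del: One_nat_def[symmetric])

lemma Ck_on_cong:
  assumes "Ck_on k S f" "open S" "\<And>x. x \<in> S \<Longrightarrow> f x = g x"
  shows "Ck_on k S g"
  using assms
proof (induction k arbitrary: f g)
  case 0
  then show ?case by (auto cong: continuous_on_cong)
next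
  case (Suc k)
  note eq = Suc.prems(3)
  have diff: "f differentiable (at x)" if "x \<in> S" for x
    using Suc.prems(1) that by simp
  have "g differentiable (at x)" if x: "x \<in> S" for x
  proof -
    have "(f has_derivative frechet_derivative f (at x)) (at x)"
      using diff[OF x] by (simp add: frechet_derivative_works)
    then have "(g has_derivative frechet_derivative f (at x)) (at x)"
      by (rule has_derivative_transform_within_open[OF _ \<open>open S\<close> x]) (rule eq)
    then show ?thesis by (auto simp: differentiable_def)
  qed
  moreover have "Ck_on k S (\<lambda>x. frechet_derivative g (at x) v)" for v
  proof (rule Suc.IH)
    show "Ck_on k S (\<lambda>x. frechet_derivative f (at x) v)"
      using Suc.prems(1) by simp
    show "frechet_derivative f (at x) v = frechet_derivative g (at x) v" if x: "x \<in> S" for x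
      by (rule fun_cong, rule frechet_derivative_transform_within_open[OF diff[OF x] \<open>open S\<close> x]) (rule eq)
  qed (rule \<open>open S\<close>)
  ultimately show ?case by simp
qed

lemma linear_frechet_derivative:
  "f differentiable (at x) \<Longrightarrow> linear (frechet_derivative f (at x))"
  using frechet_derivative_works has_derivative_linear by blast

lemma linear_expand_Basis:
  fixes L :: "'a::euclidean_space \<Rightarrow> 'b::real_vector"
  assumes "linear L"
  shows "L v = (\<Sum>b\<in>Basis. (v \<bullet> b) *\<^sub>R L b)"
  using linear_sum[OF assms, of "\<lambda>b. (v \<bullet> b) *\<^sub>R b" Basis] linear_scale[OF assms]
  by (simp add: euclidean_representation)

text \<open>The factor \<open>r\<close> closes the induction: the derivative in direction
  \<open>v\<close> is \<open>r * v\<close> times the derivative of \<open>f\<close> in direction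
  \<open>e\<close> along the line, again of the same shape.\<close>

lemma Ck_on_compose_line:
  fixes y e :: "'a::euclidean_space" and f :: "'a \<Rightarrow> 'b::real_normed_vector"
  assumes "Ck_on k S f" "open S"
  shows "Ck_on k {s::real. y + s *\<^sub>R e \<in> S} (\<lambda>s. r *\<^sub>R f (y + s *\<^sub>R e))"
  using assms(1)
proof (induction k arbitrary: f r)
  case 0
  then show ?case
    by (auto intro!: continuous_intros intro: continuous_on_compose2)
next
  case (Suc k)
  have op: "open {s::real. y + s *\<^sub>R e \<in> S}"
    using \<open>open S\<close> by (intro continuous_open_vimage[unfolded vimage_def]) (auto intro!: continuous_intros)
  have der: "((\<lambda>s. r *\<^sub>R f (y + s *\<^sub>R e)) has_derivative
      (\<lambda>v. (r * v) *\<^sub>R frechet_derivative f (at (y + s *\<^sub>R e)) e)) (at s)" if "y + s *\<^sub>R e \<in> S" for s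
  proof -
    have d: "f differentiable (at (y + s *\<^sub>R e))" using Suc.prems that by simp
    have "((f \<circ> (\<lambda>s. y + s *\<^sub>R e)) has_derivative
        (frechet_derivative f (at (y + s *\<^sub>R e)) \<circ> (\<lambda>v. v *\<^sub>R e))) (at s)"
      by (rule diff_chain_at) (use d frechet_derivative_works in \<open>auto intro!: derivative_eq_intros\<close>)
    then have "((\<lambda>s. r *\<^sub>R f (y + s *\<^sub>R e)) has_derivative
        (\<lambda>v. r *\<^sub>R frechet_derivative f (at (y + s *\<^sub>R e)) (v *\<^sub>R e))) (at s)"
      by (auto intro!: derivative_intros simp: o_def)
    then show ?thesis using linear_scale[OF linear_frechet_derivative[OF d]] by simp
  qed
  have "Ck_on k {s. y + s *\<^sub>R e \<in> S} (\<lambda>s. frechet_derivative (\<lambda>s. r *\<^sub>R f (y + s *\<^sub>R e)) (at s) v)" for v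
    using Suc.prems frechet_derivative_at[OF der]
    by (intro Ck_on_cong[OF Suc.IH[of "\<lambda>x. frechet_derivative f (at x) e" "r * v"] op]) (auto simp: fun_eq_iff)
  then show ?case using der by (auto simp: differentiable_def)
qed

text \<open>\<open>Ck_on\<close> gives continuity in the base point for each fixed direction only.
  Expanding the direction in the finite basis lets base point and direction vary together.\<close>

lemma continuous_on_frechet_derivative:
  fixes f :: "'a::euclidean_space \<Rightarrow> 'b::real_normed_vector"
  assumes f: "Ck_on 1 S f" and p: "continuous_on T p" "p ` T \<subseteq> S" and w: "continuous_on T w"
  shows "continuous_on T (\<lambda>z. frechet_derivative f (at (p z)) (w z))"
proof -
  have "continuous_on T (\<lambda>z. \<Sum>b\<in>Basis. (w z \<bullet> b) *\<^sub>R frechet_derivative f (at (p z)) b)"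
    using f p w unfolding Ck_on_1
    by (intro continuous_intros)
      (auto intro: continuous_on_compose2[where g = "\<lambda>x. frechet_derivative f (at x) _"])
  moreover have "frechet_derivative f (at (p z)) (w z) =
      (\<Sum>b\<in>Basis. (w z \<bullet> b) *\<^sub>R frechet_derivative f (at (p z)) b)" if "z \<in> T" for z
    using f p(2) that by (intro linear_expand_Basis linear_frechet_derivative) (auto simp: Ck_on_1)
  ultimately show ?thesis by (simp cong: continuous_on_cong)
qed

lemma Ck_on_1_imp_continuous_on: "Ck_on 1 S f \<Longrightarrow> continuous_on S f"
  by (auto simp: Ck_on_1 intro!: continuous_at_imp_continuous_on differentiable_imp_continuous_within)

lemma Ck_on_1_compose:
  fixes f :: "'b::euclidean_space \<Rightarrow> 'c::real_normed_vector" and h :: "'a::euclidean_space \<Rightarrow> 'b"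
  assumes f: "Ck_on 1 S f" and h: "Ck_on 1 T h" "h ` T \<subseteq> S"
  shows "Ck_on 1 T (f \<circ> h)"
proof -
  have "frechet_derivative (f \<circ> h) (at x) =
      (\<lambda>v. frechet_derivative f (at (h x)) (frechet_derivative h (at x) v))" if "x \<in> T" for x
    using assms that by (subst frechet_derivative_compose) (auto simp: Ck_on_1)
  moreover have "continuous_on T (\<lambda>x. frechet_derivative f (at (h x)) (frechet_derivative h (at x) v))" for v
    using assms Ck_on_1_imp_continuous_on[OF h(1)]
    by (intro continuous_on_frechet_derivative[OF f]) (auto simp: Ck_on_1)
  ultimately show ?thesis
    using assms by (auto simp: Ck_on_1 intro!: differentiable_chain_at cong: continuous_on_cong)
qed

text \<open>Makes it possible to use a different target chart near each point.\<close>

lemma Ck_on_1_local: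
  assumes "\<And>x. x \<in> S \<Longrightarrow> \<exists>V. open V \<and> x \<in> V \<and> Ck_on 1 V f"
  shows "Ck_on 1 S f"
proof -
  have "continuous (at x) (\<lambda>x. frechet_derivative f (at x) v)" if "x \<in> S" for x v
    using assms[OF that] by (auto simp: Ck_on_1 continuous_on_eq_continuous_at)
  then show ?thesis
    using assms by (fastforce simp: Ck_on_1 intro!: continuous_at_imp_continuous_on)
qed

section \<open>Measurability and convergence of expectations\<close>

text \<open>The sublevel sets of \<open>f\<close> and \<open>g\<close> differ inside a null set,
  which completeness makes measurable. The derivative of the flow is identified only almost surely,
  so its measurability always comes this way.\<close>

lemma (in complete_measure) borel_measurable_AE_eq:
  fixes f g :: "'a \<Rightarrow> real"
  assumes f: "f \<in> borel_measurable M" and eq: "AE x in M. f x = g x"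
  shows "g \<in> borel_measurable M"
proof (rule borel_measurableI_less)
  fix a
  have "{x \<in> space M. f x < a} \<in> sets M" using f by measurable
  moreover have "AE x in M. x \<in> {x \<in> space M. f x < a} \<longleftrightarrow> x \<in> {x \<in> space M. g x < a}"
    using eq by eventually_elim auto
  ultimately show "{x \<in> space M. g x < a} \<in> sets M"
    by (intro in_sets_AE[of "{x \<in> space M. f x < a}" "{x \<in> space M. g x < a}"]) auto
qed

text \<open>Caratheodory functions are jointly measurable: they are limits of functions whose
  \<open>s\<close>-argument is rounded to a grid.\<close>

lemma borel_measurable_pair_of_continuous:
  fixes H :: "real \<Rightarrow> 'w \<Rightarrow> real"
  assumes meas: "\<And>s. H s \<in> borel_measurable M"
    and cont: "\<And>\<omega>. \<omega> \<in> space M \<Longrightarrow> continuous_on UNIV (\<lambda>s. H s \<omega>)"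
  shows "(\<lambda>(s, \<omega>). H s \<omega>) \<in> borel_measurable (borel \<Otimes>\<^sub>M M)"
proof (rule borel_measurable_LIMSEQ_real)
  \<comment> \<open>\<open>r n s\<close> rounds \<open>s\<close> down to a multiple of
    \<open>1 / Suc n\<close>. It takes countably many values, so the rounded function is measurable
    piece by piece.\<close>
  define r where "r n s = real_of_int \<lfloor>real (Suc n) * s\<rfloor> / real (Suc n)" for n s
  have r_lim: "(\<lambda>n. r n s) \<longlonglongrightarrow> s" for s
  proof (rule tendsto_sandwich)
    show "\<forall>\<^sub>F n in sequentially. s - 1 / real (Suc n) \<le> r n s"
    proof (intro always_eventually allI)
      fix n
      have "real (Suc n) * s - 1 \<le> real_of_int \<lfloor>real (Suc n) * s\<rfloor>" by linarith
      then have "(real (Suc n) * s - 1) / real (Suc n) \<le> r n s"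
        unfolding r_def by (intro divide_right_mono) auto
      then show "s - 1 / real (Suc n) \<le> r n s" by (simp add: diff_divide_distrib)
    qed
    show "\<forall>\<^sub>F n in sequentially. r n s \<le> s"
      unfolding r_def by (intro always_eventually allI) (simp add: field_simps)
    show "(\<lambda>n. s - 1 / real (Suc n)) \<longlonglongrightarrow> s"
      using tendsto_diff[OF tendsto_const LIMSEQ_Suc[OF lim_1_over_n]] by simp
  qed simp
  show "(\<lambda>(s, \<omega>). H (r n s) \<omega>) \<in> borel_measurable (borel \<Otimes>\<^sub>M M)" for n
  proof -
    have "(\<lambda>p. H (real_of_int \<lfloor>real (Suc n) * fst p\<rfloor> / real (Suc n)) (snd p))
        \<in> borel_measurable (borel \<Otimes>\<^sub>M M)"
    proof (rule measurable_compose_countable[where f = "\<lambda>i p. H (real_of_int i / real (Suc n)) (snd p)"])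
      show "(\<lambda>p. H (real_of_int i / real (Suc n)) (snd p)) \<in> borel_measurable (borel \<Otimes>\<^sub>M M)" for i
        by (rule measurable_compose[OF measurable_snd meas])
      show "(\<lambda>p. \<lfloor>real (Suc n) * fst p\<rfloor>) \<in> borel \<Otimes>\<^sub>M M \<rightarrow>\<^sub>M count_space UNIV"
        by measurable
    qed
    then show ?thesis by (simp add: r_def case_prod_beta)
  qed
  show "(\<lambda>n. (\<lambda>(s, \<omega>). H (r n s) \<omega>) p) \<longlonglongrightarrow> (\<lambda>(s, \<omega>). H s \<omega>) p" if "p \<in> space (borel \<Otimes>\<^sub>M M)" for p
  proof -
    have "isCont (\<lambda>s. H s (snd p)) (fst p)"
      using cont[of "snd p"] that by (auto simp: space_pair_measure continuous_on_eq_continuous_at)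
    from isCont_tendsto_compose[OF this r_lim] show ?thesis by (simp add: case_prod_beta)
  qed
qed

lemma le_one_plus_powr:
  fixes x q :: real
  assumes "q \<ge> 1" "x \<ge> 0"
  shows "x \<le> 1 + x powr q"
proof (cases "x \<le> 1")
  case False
  then have "x powr 1 \<le> x powr q" using assms by (intro powr_mono) auto
  then show ?thesis using False by simp
qed (use powr_ge_zero[of x q] in linarith)

section \<open>Expectations under a bounded moment of order above 1\<close>

context prob_space
begin

text \<open>Moment bounds are stated with the nonnegative integral, which makes sense before
  integrability is known; this lemma is the passage to Bochner integrals.\<close>

lemma integrable_powr_moment:
  fixes X :: "'a \<Rightarrow> real"
  assumes [measurable]: "X \<in> borel_measurable M"
    and b: "(\<integral>\<^sup>+\<omega>. ennreal (\<bar>X \<omega>\<bar> powr q) \<partial>M) \<le> ennreal c"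
  shows "integrable M (\<lambda>\<omega>. \<bar>X \<omega>\<bar> powr q)"
  using b by (intro integrableI_bounded) (auto simp: order_le_less_trans)

lemma expectation_powr_moment_le:
  fixes X :: "'a \<Rightarrow> real"
  assumes [measurable]: "X \<in> borel_measurable M" and c: "0 \<le> c"
    and b: "(\<integral>\<^sup>+\<omega>. ennreal (\<bar>X \<omega>\<bar> powr q) \<partial>M) \<le> ennreal c"
  shows "expectation (\<lambda>\<omega>. \<bar>X \<omega>\<bar> powr q) \<le> c"
proof -
  have "ennreal (expectation (\<lambda>\<omega>. \<bar>X \<omega>\<bar> powr q)) \<le> ennreal c"
    using b by (subst nn_integral_eq_integral[OF integrable_powr_moment[OF _ b], symmetric]) auto
  then show ?thesis using c by (simp add: ennreal_le_iff)
qed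

lemma integrable_of_powr_moment:
  fixes X :: "'a \<Rightarrow> real"
  assumes X[measurable]: "X \<in> borel_measurable M" and q: "q \<ge> 1"
    and b: "(\<integral>\<^sup>+\<omega>. ennreal (\<bar>X \<omega>\<bar> powr q) \<partial>M) \<le> ennreal c"
  shows "integrable M X"
proof (rule Bochner_Integration.integrable_bound)
  show "integrable M (\<lambda>\<omega>. 1 + \<bar>X \<omega>\<bar> powr q)"
    using integrable_powr_moment[OF X b] by simp
  show "AE \<omega> in M. norm (X \<omega>) \<le> norm (1 + \<bar>X \<omega>\<bar> powr q)"
    using le_one_plus_powr[OF q] by (auto intro!: AE_I2 order_trans[OF le_one_plus_powr[OF q]])
qed measurable

lemma expectation_abs_le_of_powr_moment:
  fixes X :: "'a \<Rightarrow> real"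
  assumes X[measurable]: "X \<in> borel_measurable M" and q: "q \<ge> 1" and c: "0 \<le> c"
    and b: "(\<integral>\<^sup>+\<omega>. ennreal (\<bar>X \<omega>\<bar> powr q) \<partial>M) \<le> ennreal c"
  shows "expectation (\<lambda>\<omega>. \<bar>X \<omega>\<bar>) \<le> 1 + c"
proof -
  have "expectation (\<lambda>\<omega>. \<bar>X \<omega>\<bar>) \<le> expectation (\<lambda>\<omega>. 1 + \<bar>X \<omega>\<bar> powr q)"
    using integrable_of_powr_moment[OF X q b] integrable_powr_moment[OF X b] le_one_plus_powr[OF q]
    by (intro integral_mono) auto
  also have "\<dots> \<le> 1 + c"
    using expectation_powr_moment_le[OF X c b] integrable_powr_moment[OF X b] by (simp add: prob_space)
  finally show ?thesis .
qed

text \<open>Clamping changes nothing where |x| \<le> K. Elsewhere the change is at most |x|, and |x|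
  \<le> |x| (|x| / K)^d, so the moment of order 1 + d pays for it.\<close>

lemma expectation_truncation_error_le:
  fixes X :: "'a \<Rightarrow> real"
  assumes X[measurable]: "X \<in> borel_measurable M" and d: "d > 0" and c: "0 \<le> c" and K: "K > 0"
    and b: "(\<integral>\<^sup>+\<omega>. ennreal (\<bar>X \<omega>\<bar> powr (1 + d)) \<partial>M) \<le> ennreal c"
  shows "\<bar>expectation X - expectation (\<lambda>\<omega>. max (- K) (min K (X \<omega>)))\<bar> \<le> c / K powr d"
proof -
  note int = integrable_of_powr_moment[OF X _ b] integrable_powr_moment[OF X b]
  have clamp: "\<bar>x - max (- K) (min K x)\<bar> \<le> \<bar>x\<bar> powr (1 + d) / K powr d" for x :: real
  proof (cases "\<bar>x\<bar> \<le> K")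
    case False
    then have "K powr d \<le> \<bar>x\<bar> powr d" using d K by (intro powr_mono2) auto
    then have "\<bar>x\<bar> * K powr d \<le> \<bar>x\<bar> * \<bar>x\<bar> powr d" by (intro mult_left_mono) auto
    also have "\<dots> = \<bar>x\<bar> powr (1 + d)" using False K by (simp add: powr_add)
    finally have "\<bar>x\<bar> \<le> \<bar>x\<bar> powr (1 + d) / K powr d" using K by (simp add: field_simps)
    moreover have "\<bar>x - max (- K) (min K x)\<bar> \<le> \<bar>x\<bar>" using K by auto
    ultimately show ?thesis by linarith
  qed (use K in auto)
  have int2: "integrable M (\<lambda>\<omega>. max (- K) (min K (X \<omega>)))"
    using K by (intro integrable_const_bound[where B = K]) auto
  have "\<bar>expectation X - expectation (\<lambda>\<omega>. max (- K) (min K (X \<omega>)))\<bar> =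
      \<bar>expectation (\<lambda>\<omega>. X \<omega> - max (- K) (min K (X \<omega>)))\<bar>"
    using int int2 d by simp
  also have "\<dots> \<le> expectation (\<lambda>\<omega>. \<bar>X \<omega> - max (- K) (min K (X \<omega>))\<bar>)"
    by (rule integral_abs_bound)
  also have "\<dots> \<le> expectation (\<lambda>\<omega>. \<bar>X \<omega>\<bar> powr (1 + d) / K powr d)"
    using int int2 d clamp by (intro integral_mono) auto
  also have "\<dots> \<le> c / K powr d"
    using expectation_powr_moment_le[OF X c b] K by (simp add: divide_right_mono)
  finally show ?thesis .
qed

text \<open>A case of Vitali's convergence theorem. Clamping to [-K, K] costs at most c / K^d,
  uniformly in \<open>n\<close> and for the limit as well; the clamped variables converge in mean by
  dominated convergence.\<close>

lemma expectation_tendsto_of_powr_moment: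
  fixes X :: "nat \<Rightarrow> 'a \<Rightarrow> real"
  assumes X[measurable]: "\<And>n. X n \<in> borel_measurable M" and Y[measurable]: "Y \<in> borel_measurable M"
    and lim: "AE \<omega> in M. (\<lambda>n. X n \<omega>) \<longlonglongrightarrow> Y \<omega>" and d: "d > 0" and c: "0 \<le> c"
    and bX: "\<And>n. (\<integral>\<^sup>+\<omega>. ennreal (\<bar>X n \<omega>\<bar> powr (1 + d)) \<partial>M) \<le> ennreal c"
    and bY: "(\<integral>\<^sup>+\<omega>. ennreal (\<bar>Y \<omega>\<bar> powr (1 + d)) \<partial>M) \<le> ennreal c"
  shows "(\<lambda>n. expectation (X n)) \<longlonglongrightarrow> expectation Y"
proof (rule LIMSEQ_I)
  fix r :: real assume r: "r > 0"
  have "((\<lambda>K. c / K powr d) \<longlongrightarrow> 0) at_top"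
    using tendsto_mult_right_zero[OF tendsto_neg_powr[of "- d", OF _ filterlim_ident], of c] d
    by (simp add: powr_minus divide_inverse)
  then have "\<forall>\<^sub>F K in at_top. c / K powr d < r / 3"
    using r by (intro order_tendstoD) auto
  then have "\<forall>\<^sub>F K in at_top. c / K powr d < r / 3 \<and> K > 0"
    by (intro eventually_conj eventually_gt_at_top)
  then obtain K where K: "c / K powr d < r / 3" "K > 0"
    by (auto simp: eventually_at_top_linorder)
  define cl where "cl x = max (- K) (min K x)" for x :: real
  have "(\<lambda>n. expectation (\<lambda>\<omega>. cl (X n \<omega>))) \<longlonglongrightarrow> expectation (\<lambda>\<omega>. cl (Y \<omega>))"
  proof (rule integral_dominated_convergence[where w = "\<lambda>_. K"])
    show "AE \<omega> in M. (\<lambda>n. cl (X n \<omega>)) \<longlonglongrightarrow> cl (Y \<omega>)"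
      using lim unfolding cl_def by eventually_elim (intro tendsto_intros)
  qed (use K in \<open>auto simp: cl_def\<close>)
  then obtain N where N: "\<And>n. n \<ge> N \<Longrightarrow> \<bar>expectation (\<lambda>\<omega>. cl (X n \<omega>)) - expectation (\<lambda>\<omega>. cl (Y \<omega>))\<bar> < r / 3"
    using LIMSEQ_D[of _ _ "r / 3"] r by (metis divide_pos_pos real_norm_def zero_less_numeral)
  have "norm (expectation (X n) - expectation Y) < r" if "n \<ge> N" for n
    using expectation_truncation_error_le[OF X d c K(2) bX, of n]
      expectation_truncation_error_le[OF Y d c K(2) bY] N[OF that] K(1)
    unfolding cl_def real_norm_def by argo
  then show "\<exists>N. \<forall>n\<ge>N. norm (expectation (X n) - expectation Y) < r" by blast
qed

end

section \<open>Differentiation under the expectation\<close>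

lemma has_real_derivative_along_line:
  fixes f :: "'e::euclidean_space \<Rightarrow> real"
  assumes "f differentiable (at (y + s *\<^sub>R e))"
  shows "((\<lambda>s. f (y + s *\<^sub>R e)) has_real_derivative frechet_derivative f (at (y + s *\<^sub>R e)) e) (at s)"
proof -
  have "((f \<circ> (\<lambda>s. y + s *\<^sub>R e)) has_derivative
      (frechet_derivative f (at (y + s *\<^sub>R e)) \<circ> (\<lambda>v. v *\<^sub>R e))) (at s)"
    by (rule diff_chain_at) (use assms frechet_derivative_works in \<open>auto intro!: derivative_eq_intros\<close>)
  then show ?thesis
    using linear_scale[OF linear_frechet_derivative[OF assms]]
    by (simp add: has_field_derivative_def o_def mult.commute[of _ "frechet_derivative f _ e"])
qed

lemma closed_segment_eq_image_line:
  fixes y e :: "'e::real_vector"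
  shows "closed_segment y (y + e) = (\<lambda>s. y + s *\<^sub>R e) ` {0..1}"
  by (auto simp: closed_segment_def algebra_simps image_iff)

text \<open>\<open>V\<close> has to contain the segment and nothing more, because it will be an open
  set depending on \<omega> of which no shape is known.\<close>

lemma integral_along_segment:
  fixes f :: "'e::euclidean_space \<Rightarrow> real"
  assumes C1: "Ck_on 1 V f" and seg: "\<And>s. s \<in> {0..1} \<Longrightarrow> y + s *\<^sub>R e \<in> V"
  shows "(\<integral>s. indicator {0..1} s * frechet_derivative f (at (y + s *\<^sub>R e)) e \<partial>lborel) = f (y + e) - f y"
proof -
  have "(\<integral>s. indicator {0..1::real} s *\<^sub>R frechet_derivative f (at (y + s *\<^sub>R e)) e \<partial>lborel) =
      f (y + 1 *\<^sub>R e) - f (y + 0 *\<^sub>R e)"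
  proof (rule integral_FTC_Icc)
    show "((\<lambda>s. f (y + s *\<^sub>R e)) has_vector_derivative frechet_derivative f (at (y + s *\<^sub>R e)) e)
        (at s within {0..1})" if "0 \<le> s" "s \<le> 1" for s
      using has_real_derivative_along_line[of f y s e] C1 seg[of s] that
      by (auto simp: Ck_on_1 has_real_derivative_iff_has_vector_derivative
          intro: has_vector_derivative_at_within)
    show "continuous_on {0..1} (\<lambda>s. frechet_derivative f (at (y + s *\<^sub>R e)) e)"
      using seg by (intro continuous_on_frechet_derivative[OF C1] continuous_intros) auto
  qed simp
  then show ?thesis by simp
qed

text \<open>Models the payoff f(F_t) read in a chart with image \<open>S\<close>. The quantifiers in
  \<open>C1_near_segment\<close> are the ones strong 1-completeness can supply: the segment is
  chosen before the null set, and \<open>V\<close> may depend on \<omega>.\<close>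

locale random_C1_function = prob_space P + complete_measure P
  for P :: "'w measure" +
  fixes S :: "'e::euclidean_space set" and u :: "'e \<Rightarrow> 'w \<Rightarrow> real" and C :: real
  assumes open_S: "open S"
    and u_measurable[measurable]: "\<And>y. u y \<in> borel_measurable P"
    and u_bounded: "\<And>y \<omega>. \<bar>u y \<omega>\<bar> \<le> C"
    and C1_near_segment: "\<And>y z. closed_segment y z \<subseteq> S \<Longrightarrow>
      AE \<omega> in P. \<exists>V. open V \<and> closed_segment y z \<subseteq> V \<and> Ck_on 1 V (\<lambda>y. u y \<omega>)"
begin

abbreviation G :: "'e \<Rightarrow> 'e \<Rightarrow> 'w \<Rightarrow> real" where
  "G y e \<omega> \<equiv> frechet_derivative (\<lambda>y. u y \<omega>) (at y) e"

text \<open>A point is a degenerate segment.\<close>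

lemma C1_near_point:
  assumes "y \<in> S"
  shows "AE \<omega> in P. \<exists>V. open V \<and> y \<in> V \<and> Ck_on 1 V (\<lambda>y. u y \<omega>)"
  using C1_near_segment[of y y] assms by simp

text \<open>The derivative is almost surely the limit of difference quotients with increments
  \<open>1 / Suc n\<close>. Their \<open>lim\<close> is measurable everywhere, whether or not they
  converge, and completeness transfers this to \<open>G\<close>.\<close>

lemma G_measurable:
  assumes y: "y \<in> S"
  shows "G y e \<in> borel_measurable P"
proof (rule borel_measurable_AE_eq)
  let ?q = "\<lambda>n \<omega>. (u (y + (1 / real (Suc n)) *\<^sub>R e) \<omega> - u y \<omega>) / (1 / real (Suc n))"
  show "(\<lambda>\<omega>. lim (\<lambda>n. ?q n \<omega>)) \<in> borel_measurable P" by measurable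
  show "AE \<omega> in P. lim (\<lambda>n. ?q n \<omega>) = G y e \<omega>"
    using C1_near_point[OF y]
  proof eventually_elim
    case (elim \<omega>)
    then have "(\<lambda>y. u y \<omega>) differentiable (at (y + 0 *\<^sub>R e))" by (auto simp: Ck_on_1)
    from has_real_derivative_along_line[OF this]
    have "((\<lambda>h. (u (y + h *\<^sub>R e) \<omega> - u y \<omega>) / h) \<longlongrightarrow> G y e \<omega>) (at 0)"
      by (simp add: DERIV_def)
    moreover have "filterlim (\<lambda>n. 1 / real (Suc n)) (at 0) sequentially"
      using LIMSEQ_Suc[OF lim_1_over_n] by (auto simp: filterlim_at)
    ultimately have "(\<lambda>n. ?q n \<omega>) \<longlonglongrightarrow> G y e \<omega>" by (rule filterlim_compose)
    then show ?case by (rule limI)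
  qed
qed

end

text \<open>Kept apart from \<open>random_C1_function\<close> because checking the moment bound for
  the flow already uses the measurability of \<open>G\<close> proved there. The exponent may depend
  on the compact set.\<close>

locale random_C1_function_with_moments = random_C1_function P S u C
  for P :: "'w measure" and S :: "'e::euclidean_space set" and u :: "'e \<Rightarrow> 'w \<Rightarrow> real" and C :: real +
  assumes derivative_moment: "\<And>K e. compact K \<Longrightarrow> K \<subseteq> S \<Longrightarrow> \<exists>\<delta>>0. \<exists>c\<ge>0. \<forall>y\<in>K.
      (\<integral>\<^sup>+\<omega>. ennreal (\<bar>G y e \<omega>\<bar> powr (1 + \<delta>)) \<partial>P) \<le> ennreal c"
begin

lemma moment_bound:
  assumes "compact K" "K \<subseteq> S"
  obtains \<delta> c where "\<delta> > 0" "c \<ge> 0"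
    "\<And>y. y \<in> K \<Longrightarrow> (\<integral>\<^sup>+\<omega>. ennreal (\<bar>G y e \<omega>\<bar> powr (1 + \<delta>)) \<partial>P) \<le> ennreal c"
  using derivative_moment[OF assms, of e] by blast

lemma G_integrable:
  assumes y: "y \<in> S"
  shows "integrable P (G y e)"
proof -
  obtain \<delta> c where "\<delta> > 0" "(\<integral>\<^sup>+\<omega>. ennreal (\<bar>G y e \<omega>\<bar> powr (1 + \<delta>)) \<partial>P) \<le> ennreal c"
    by (rule moment_bound[of "{y}" e]) (use y in auto)
  then show ?thesis by (intro integrable_of_powr_moment[OF G_measurable[OF y], of "1 + \<delta>"]) auto
qed

lemma u_integrable: "integrable P (u y)"
  using u_bounded by (intro integrable_const_bound[where B = C]) auto

text \<open>A compact ball supplies one exponent and one bound for all its points, that is, uniform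
  integrability along any sequence in it.\<close>

lemma expectation_G_continuous: "continuous_on S (\<lambda>y. expectation (G y e))"
proof (rule continuous_at_imp_continuous_on, rule ballI)
  fix x assume "x \<in> S"
  then obtain r where r: "r > 0" "cball x r \<subseteq> S" using open_S open_contains_cball by blast
  obtain \<delta> c where dc: "\<delta> > 0" "c \<ge> 0"
      "\<And>y. y \<in> cball x r \<Longrightarrow> (\<integral>\<^sup>+\<omega>. ennreal (\<bar>G y e \<omega>\<bar> powr (1 + \<delta>)) \<partial>P) \<le> ennreal c"
    using moment_bound[of "cball x r" e] r by auto
  have "continuous_on (cball x r) (\<lambda>y. expectation (G y e))"
    unfolding continuous_on_sequentially
  proof (intro allI ballI impI)
    fix z a assume a: "a \<in> cball x r" and z: "(\<forall>n. z n \<in> cball x r) \<and> z \<longlonglongrightarrow> a"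
    \<comment> \<open>Only the limit point \<open>a\<close> needs a C1 neighbourhood: for almost
      every \<omega> the sequence eventually enters it, so no null sets for the \<open>z n\<close>
      have to be collected.\<close>
    have "AE \<omega> in P. (\<lambda>n. G (z n) e \<omega>) \<longlonglongrightarrow> G a e \<omega>"
      using C1_near_point[OF subsetD[OF r(2) a]]
    proof eventually_elim
      case (elim \<omega>)
      then have "isCont (\<lambda>y. G y e \<omega>) a" by (auto simp: Ck_on_1 continuous_on_eq_continuous_at)
      then show ?case using z by (auto intro: isCont_tendsto_compose)
    qed
    then have "(\<lambda>n. expectation (G (z n) e)) \<longlonglongrightarrow> expectation (G a e)"
      using z a r(2) dc by (intro expectation_tendsto_of_powr_moment[of _ _ \<delta> c] G_measurable) auto
    then show "((\<lambda>y. expectation (G y e)) \<circ> z) \<longlonglongrightarrow> expectation (G a e)" by (simp add: o_def)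
  qed
  then show "isCont (\<lambda>y. expectation (G y e)) x"
    using r(1) by (intro continuous_on_interior) (auto simp: interior_cball)
qed

lemma expectation_G_linear:
  assumes y: "y \<in> S"
  shows "linear (\<lambda>e. expectation (G y e))"
proof (rule linearI)
  have lin: "AE \<omega> in P. linear (\<lambda>e. G y e \<omega>)"
    using C1_near_point[OF y] by eventually_elim (auto simp: Ck_on_1 intro: linear_frechet_derivative)
  fix a b :: 'e and r :: real
  have "expectation (G y (a + b)) = expectation (\<lambda>\<omega>. G y a \<omega> + G y b \<omega>)"
    by (rule integral_cong_AE) (use lin y in \<open>auto simp: linear_add intro: borel_measurable_add G_measurable\<close>)
  then show "expectation (G y (a + b)) = expectation (G y a) + expectation (G y b)"
    using G_integrable[OF y] by simp
  have "expectation (G y (r *\<^sub>R a)) = expectation (\<lambda>\<omega>. r *\<^sub>R G y a \<omega>)"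
    by (rule integral_cong_AE)
      (use lin y in \<open>auto simp: linear_scale intro!: borel_measurable_times G_measurable\<close>)
  then show "expectation (G y (r *\<^sub>R a)) = r *\<^sub>R expectation (G y a)"
    by simp
qed

text \<open>For almost every \<omega> one C1 neighbourhood contains the whole segment, so the
  fundamental theorem of calculus holds pathwise; Fubini then exchanges the integrals. The effort
  goes into joint measurability and integrability of the integrand.\<close>

lemma expectation_increment:
  assumes seg: "closed_segment y (y + e) \<subseteq> S"
  shows "(\<integral>s. indicator {0..1} s * expectation (G (y + s *\<^sub>R e) e) \<partial>lborel) =
    expectation (u (y + e)) - expectation (u y)"
proof -
  note seg_iff = closed_segment_eq_image_line[of y e]
  have in_S: "y + s *\<^sub>R e \<in> S" if "s \<in> {0..1}" for s
    using seg seg_iff that by blast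
  obtain N where N: "N \<in> null_sets P" "\<And>\<omega>. \<omega> \<in> space P - N \<Longrightarrow>
      \<exists>V. open V \<and> closed_segment y (y + e) \<subseteq> V \<and> Ck_on 1 V (\<lambda>y. u y \<omega>)"
    by (rule AE_E3[OF C1_near_segment[OF seg]]) (rule that)
  \<comment> \<open>One exceptional set \<open>N\<close> serves every point of the segment, so the
    good event does not depend on \<open>s\<close>.\<close>
  define \<Omega> where "\<Omega> = space P - N"
  have [measurable]: "\<Omega> \<in> sets P" using N(1) by (auto simp: \<Omega>_def)
  have AE_\<Omega>: "AE \<omega> in P. \<omega> \<in> \<Omega>"
    using AE_not_in[OF N(1)] AE_space by eventually_elim (simp add: \<Omega>_def)
  have good: "\<exists>V. (\<forall>s\<in>{0..1}. y + s *\<^sub>R e \<in> V) \<and> Ck_on 1 V (\<lambda>y. u y \<omega>)" if \<omega>: "\<omega> \<in> \<Omega>" for \<omega>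
  proof -
    obtain V where "closed_segment y (y + e) \<subseteq> V" "Ck_on 1 V (\<lambda>y. u y \<omega>)"
      using N(2)[OF \<omega>[unfolded \<Omega>_def]] by (elim exE conjE)
    then show ?thesis unfolding seg_iff by blast
  qed
  \<comment> \<open>Clamping extends the integrand to a function continuous in \<open>s\<close> on the whole line, as joint
    measurability requires.\<close>
  define cl where "cl s = max 0 (min 1 s)" for s :: real
  have cl: "cl s \<in> {0..1}" "s \<in> {0..1} \<Longrightarrow> cl s = s" for s by (auto simp: cl_def)
  have G_meas: "G (y + cl s *\<^sub>R e) e \<in> borel_measurable P" for s
    by (rule G_measurable[OF in_S[OF cl(1)]])
  \<comment> \<open>Vanishing off the good event makes \<open>H\<close> continuous in
    \<open>s\<close> for every \<omega>, not merely for almost every one.\<close>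
  define H where "H s \<omega> = indicator \<Omega> \<omega> * G (y + cl s *\<^sub>R e) e \<omega>" for s \<omega>
  have "(\<lambda>(s, \<omega>). H s \<omega>) \<in> borel_measurable (borel \<Otimes>\<^sub>M P)"
  proof (rule borel_measurable_pair_of_continuous)
    show "H s \<in> borel_measurable P" for s
      unfolding H_def by (rule borel_measurable_times[OF borel_measurable_indicator[OF \<open>\<Omega> \<in> sets P\<close>] G_meas])
    show "continuous_on UNIV (\<lambda>s. H s \<omega>)" for \<omega>
    proof (cases "\<omega> \<in> \<Omega>")
      case True
      obtain V where V: "\<forall>s\<in>{0..1}. y + s *\<^sub>R e \<in> V" "Ck_on 1 V (\<lambda>y. u y \<omega>)"
        using good[OF True] by (elim exE conjE)
      have "continuous_on UNIV (\<lambda>s. G (y + cl s *\<^sub>R e) e \<omega>)"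
      proof (rule continuous_on_frechet_derivative[OF V(2)])
        show "continuous_on UNIV (\<lambda>s. y + cl s *\<^sub>R e)"
          unfolding cl_def by (intro continuous_intros)
      qed (use V(1) cl in auto)
      then show ?thesis using True by (simp add: H_def)
    qed (simp add: H_def)
  qed
  then have H_meas[measurable]: "(\<lambda>(s, \<omega>). H s \<omega>) \<in> borel_measurable (lborel \<Otimes>\<^sub>M P)"
    by (simp cong: measurable_cong_sets sets_pair_measure_cong)
  obtain \<delta> c where dc: "\<delta> > 0" "c \<ge> 0" "\<And>z. z \<in> closed_segment y (y + e) \<Longrightarrow>
      (\<integral>\<^sup>+\<omega>. ennreal (\<bar>G z e \<omega>\<bar> powr (1 + \<delta>)) \<partial>P) \<le> ennreal c"
    using moment_bound[OF compact_segment seg, of e] by blast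
  have H_eq: "AE \<omega> in P. H s \<omega> = G (y + cl s *\<^sub>R e) e \<omega>" for s
    using AE_\<Omega> by eventually_elim (simp add: H_def)
  have H_meas1[measurable]: "H s \<in> borel_measurable P" for s
    unfolding H_def by (rule borel_measurable_times[OF borel_measurable_indicator[OF \<open>\<Omega> \<in> sets P\<close>] G_meas])
  have H_int: "integrable P (H s)" for s
    using G_integrable[OF in_S[OF cl(1)], of s e] H_eq
    by (subst integrable_cong_AE[OF H_meas1 G_meas]) auto
  \<comment> \<open>The bound comes from |x| \<le> 1 + |x|^(1 + \<delta>). It is uniform in
    \<open>s\<close> because the segment is compact, hence integrable over the unit
    interval.\<close>
  have H_bound: "expectation (\<lambda>\<omega>. \<bar>H s \<omega>\<bar>) \<le> 1 + c" for s
  proof -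
    have "expectation (\<lambda>\<omega>. \<bar>H s \<omega>\<bar>) = expectation (\<lambda>\<omega>. \<bar>G (y + cl s *\<^sub>R e) e \<omega>\<bar>)"
      by (rule integral_cong_AE)
        (use H_eq[of s] G_meas in \<open>auto intro!: borel_measurable_abs\<close>)
    also have "\<dots> \<le> 1 + c"
    proof (rule expectation_abs_le_of_powr_moment[OF G_meas _ dc(2)])
      show "(\<integral>\<^sup>+\<omega>. ennreal (\<bar>G (y + cl s *\<^sub>R e) e \<omega>\<bar> powr (1 + \<delta>)) \<partial>P) \<le> ennreal c"
        using cl(1)[of s] by (intro dc(3)) (auto simp only: seg_iff)
    qed (use dc(1) in simp)
    finally show ?thesis .
  qed
  interpret pair_sigma_finite lborel P ..
  have int: "integrable (lborel \<Otimes>\<^sub>M P) (\<lambda>(s, \<omega>). indicator {0..1} s * H s \<omega>)"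
  proof (rule Fubini_integrable)
    show meas: "(\<lambda>(s, \<omega>). indicator {0..1} s * H s \<omega>) \<in> borel_measurable (lborel \<Otimes>\<^sub>M P)"
      using H_meas by (simp add: case_prod_beta)
    show "AE s in lborel. integrable P (\<lambda>\<omega>. (\<lambda>(s, \<omega>). indicator {0..1} s * H s \<omega>) (s, \<omega>))"
      using H_int by simp
    show "integrable lborel (\<lambda>s. \<integral>\<omega>. norm ((\<lambda>(s, \<omega>). indicator {0..1} s * H s \<omega>) (s, \<omega>)) \<partial>P)"
    proof (rule Bochner_Integration.integrable_bound)
      show "integrable lborel (\<lambda>s. indicator {0..1::real} s *\<^sub>R (1 + c))"
        by (intro integrable_real_indicator integrable_scaleR_left) auto
      show "(\<lambda>s. \<integral>\<omega>. norm ((\<lambda>(s, \<omega>). indicator {0..1} s * H s \<omega>) (s, \<omega>)) \<partial>P) \<in> borel_measurable lborel"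
        using meas by measurable
      show "AE s in lborel. norm (\<integral>\<omega>. norm ((\<lambda>(s, \<omega>). indicator {0..1} s * H s \<omega>) (s, \<omega>)) \<partial>P)
          \<le> norm (indicator {0..1::real} s *\<^sub>R (1 + c))"
        using H_bound dc(2) by (intro AE_I2) (auto simp: indicator_def)
    qed
  qed
  have "(\<integral>s. indicator {0..1} s * expectation (G (y + s *\<^sub>R e) e) \<partial>lborel) =
      (\<integral>s. (\<integral>\<omega>. indicator {0..1} s * H s \<omega> \<partial>P) \<partial>lborel)"
  proof (rule Bochner_Integration.integral_cong)
    fix s :: real
    have "expectation (H s) = expectation (G (y + cl s *\<^sub>R e) e)"
      using H_eq by (intro integral_cong_AE H_meas1 G_meas)
    then show "indicator {0..1} s * expectation (G (y + s *\<^sub>R e) e) =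
        (\<integral>\<omega>. indicator {0..1} s * H s \<omega> \<partial>P)"
      using cl(2)[of s] by (auto simp: indicator_def)
  qed simp
  also have "\<dots> = (\<integral>\<omega>. (\<integral>s. indicator {0..1} s * H s \<omega> \<partial>lborel) \<partial>P)"
    by (rule Fubini_integral[OF int, symmetric])
  also have "\<dots> = (\<integral>\<omega>. u (y + e) \<omega> - u y \<omega> \<partial>P)"
  proof (rule integral_cong_AE)
    show "AE \<omega> in P. (\<integral>s. indicator {0..1} s * H s \<omega> \<partial>lborel) = u (y + e) \<omega> - u y \<omega>"
      using AE_\<Omega>
    proof eventually_elim
      case (elim \<omega>)
      obtain V where V: "\<forall>s\<in>{0..1}. y + s *\<^sub>R e \<in> V" "Ck_on 1 V (\<lambda>y. u y \<omega>)"
        using good[OF elim] by (elim exE conjE)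
      have "(\<integral>s. indicator {0..1} s * H s \<omega> \<partial>lborel) =
          (\<integral>s. indicator {0..1} s * G (y + s *\<^sub>R e) e \<omega> \<partial>lborel)"
        using elim cl(2) by (intro Bochner_Integration.integral_cong) (auto simp: H_def indicator_def)
      then show ?case using integral_along_segment[OF V(2) bspec[OF V(1)]] by simp
    qed
    show "(\<lambda>\<omega>. \<integral>s. indicator {0..1} s * H s \<omega> \<partial>lborel) \<in> borel_measurable P"
      using integrable_snd[OF int] by (auto simp: borel_measurable_integrable)
  qed measurable
  also have "\<dots> = expectation (u (y + e)) - expectation (u y)"
    by (intro Bochner_Integration.integral_diff u_integrable)
  finally show ?thesis .
qed

text \<open>By \<open>expectation_increment\<close> the error of the linear approximation is the
  average over the segment of the change in the expected derivative, which continuity makes small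
  relative to the length of the step.\<close>

lemma expectation_has_derivative:
  assumes y: "y \<in> S"
  shows "((\<lambda>y. expectation (u y)) has_derivative (\<lambda>e. expectation (G y e))) (at y)"
  unfolding has_derivative_at_alt
proof (intro conjI allI impI)
  show "bounded_linear (\<lambda>e. expectation (G y e))"
    using expectation_G_linear[OF y] by (rule linear_conv_bounded_linear[THEN iffD1])
  fix \<epsilon> :: real assume \<epsilon>: "\<epsilon> > 0"
  \<comment> \<open>A direction \<open>e\<close> splits into DIM('e) basis components, each at most
    \<open>norm e\<close> in absolute value, so an error \<eta> per basis direction adds up to
    \<epsilon> \<open>norm e\<close>. Since the basis is finite, one radius serves all its
    directions.\<close>
  define \<eta> where "\<eta> = \<epsilon> / DIM('e)"
  have \<eta>: "\<eta> > 0" using \<epsilon> by (simp add: \<eta>_def)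
  have "\<forall>b. \<forall>\<^sub>F z in nhds y. \<bar>expectation (G z b) - expectation (G y b)\<bar> < \<eta>"
    using expectation_G_continuous y open_S \<eta>
    by (auto simp: continuous_on_eq_continuous_at isCont_def tendsto_iff dist_real_def
        eventually_nhds_conv_at)
  then have "\<forall>\<^sub>F z in nhds y. z \<in> S \<and> (\<forall>b\<in>Basis. \<bar>expectation (G z b) - expectation (G y b)\<bar> < \<eta>)"
    using eventually_nhds_in_open[OF open_S y] by (intro eventually_conj eventually_ball_finite) auto
  then obtain r where r: "r > 0" "\<And>z. dist z y < r \<Longrightarrow> z \<in> S"
      "\<And>z b. dist z y < r \<Longrightarrow> b \<in> Basis \<Longrightarrow> \<bar>expectation (G z b) - expectation (G y b)\<bar> < \<eta>"
    unfolding eventually_nhds_metric by blast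
  have "\<bar>expectation (u (y + e)) - expectation (u y) - expectation (G y e)\<bar> \<le> \<epsilon> * norm e"
    if e: "norm e < r" for e
  proof -
    have near: "dist (y + s *\<^sub>R e) y < r" if "s \<in> {0..1}" for s
      using that e mult_left_le_one_le[of "norm e" s] by (simp add: dist_norm)
    note seg = closed_segment_eq_image_line[of y e]
    have in_S: "y + s *\<^sub>R e \<in> S" if "s \<in> {0..1}" for s using near r(2) that by blast
    let ?L = "\<lambda>s. expectation (G (y + s *\<^sub>R e) e)"
    have diff: "\<bar>?L s - expectation (G y e)\<bar> \<le> \<epsilon> * norm e" if s: "s \<in> {0..1}" for s
    proof -
      let ?D = "\<lambda>b. expectation (G (y + s *\<^sub>R e) b) - expectation (G y b)"
      have "linear ?D"
        using expectation_G_linear[OF in_S[OF s]] expectation_G_linear[OF y] by (rule linear_compose_sub)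
      then have "?D e = (\<Sum>b\<in>Basis. (e \<bullet> b) *\<^sub>R ?D b)" by (rule linear_expand_Basis)
      then have "\<bar>?D e\<bar> \<le> (\<Sum>b\<in>(Basis :: 'e set). norm e * \<eta>)"
        unfolding real_scaleR_def
        by (simp only:, intro order_trans[OF sum_abs] sum_mono)
          (auto simp: abs_mult Basis_le_norm intro!: mult_mono less_imp_le[OF r(3)[OF near[OF s]]])
      also have "\<dots> = \<epsilon> * norm e" by (simp add: \<eta>_def)
      finally show ?thesis .
    qed
    have cont: "continuous_on {0..1} ?L"
      using in_S by (intro continuous_on_compose2[OF expectation_G_continuous] continuous_intros) auto
    have int: "integrable lborel (\<lambda>s. indicator {0..1} s *\<^sub>R ?L s)"
      using borel_integrable_compact[OF compact_Icc cont] by simp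
    have int2: "integrable lborel (\<lambda>s. indicator {0..1::real} s *\<^sub>R a)" for a :: real
      by (intro integrable_real_indicator integrable_scaleR_left) auto
    have const: "(\<integral>s. indicator {0..1::real} s *\<^sub>R a \<partial>lborel) = a" for a :: real by simp
    \<comment> \<open>The unit interval has length 1, so the constant
      \<open>expectation (G y e)\<close> is its own integral and can be taken inside.\<close>
    have "expectation (u (y + e)) - expectation (u y) - expectation (G y e) =
        (\<integral>s. indicator {0..1} s *\<^sub>R ?L s - indicator {0..1} s *\<^sub>R expectation (G y e) \<partial>lborel)"
      using expectation_increment[of y e] in_S
      by (subst Bochner_Integration.integral_diff[OF int int2], subst const) (simp add: seg image_subset_iff)
    then have "\<bar>expectation (u (y + e)) - expectation (u y) - expectation (G y e)\<bar> \<le>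
        (\<integral>s. \<bar>indicator {0..1} s *\<^sub>R ?L s - indicator {0..1} s *\<^sub>R expectation (G y e)\<bar> \<partial>lborel)"
      by (simp only: integral_abs_bound)
    also have "\<dots> \<le> (\<integral>s. indicator {0..1::real} s *\<^sub>R (\<epsilon> * norm e) \<partial>lborel)"
      using diff int int2 by (intro integral_mono) (auto simp: indicator_def)
    finally show ?thesis using const by simp
  qed
  then show "\<exists>d>0. \<forall>z. norm (z - y) < d \<longrightarrow>
      norm (expectation (u z) - expectation (u y) - expectation (G y (z - y))) \<le> \<epsilon> * norm (z - y)"
    using r(1) by (intro exI[of _ r]) (metis add.commute diff_add_cancel real_norm_def)
qed

lemma expectation_C1: "Ck_on 1 S (\<lambda>y. expectation (u y))"
proof -
  have "frechet_derivative (\<lambda>y. expectation (u y)) (at y) = (\<lambda>e. expectation (G y e))" if "y \<in> S" for y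
    using frechet_derivative_at[OF expectation_has_derivative[OF that]] by simp
  then show ?thesis
    using expectation_has_derivative expectation_G_continuous
    by (auto simp: Ck_on_1 differentiable_def cong: continuous_on_cong)
qed

end

section \<open>Coordinate expressions\<close>

context
  fixes \<A> :: "('m::{second_countable_topology,t2_space}, 'e::euclidean_space) chart set"
  assumes atlas: "smooth_atlas \<A>"
begin

lemma chart_homeomorphism:
  "c \<in> \<A> \<Longrightarrow> homeomorphism (cdom c) (cmap c ` cdom c) (cmap c) (cinv c)"
  using atlas by (simp add: smooth_atlas_def)

lemma open_cdom: "c \<in> \<A> \<Longrightarrow> open (cdom c)"
  and open_chart_image: "c \<in> \<A> \<Longrightarrow> open (cmap c ` cdom c)"
  using atlas by (simp_all add: smooth_atlas_def)

lemma
  assumes "c \<in> \<A>"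
  shows cinv_cmap: "x \<in> cdom c \<Longrightarrow> cinv c (cmap c x) = x"
    and cmap_cinv: "y \<in> cmap c ` cdom c \<Longrightarrow> cmap c (cinv c y) = y"
    and cinv_in_cdom: "y \<in> cmap c ` cdom c \<Longrightarrow> cinv c y \<in> cdom c"
    and continuous_on_cmap: "continuous_on (cdom c) (cmap c)"
    and continuous_on_cinv: "continuous_on (cmap c ` cdom c) (cinv c)"
  using chart_homeomorphism[OF assms] unfolding homeomorphism_def by blast+

lemma chart_at_in: "chart_at \<A> x \<in> \<A>" "x \<in> cdom (chart_at \<A> x)"
proof -
  have "x \<in> (\<Union>c\<in>\<A>. cdom c)" using atlas by (simp add: smooth_atlas_def)
  then have "\<exists>c. c \<in> \<A> \<and> x \<in> cdom c" by blast
  from someI_ex[OF this] show "chart_at \<A> x \<in> \<A>" "x \<in> cdom (chart_at \<A> x)"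
    by (auto simp: chart_at_def)
qed

text \<open>The image of \<open>W\<close> is its preimage under the continuous inverse chart, taken
  inside the open image of the chart.\<close>

lemma open_chart_image_subset:
  assumes c: "c \<in> \<A>" and W: "open W" "W \<subseteq> cdom c"
  shows "open (cmap c ` W)"
proof -
  have "cmap c ` W = cmap c ` cdom c \<inter> cinv c -` W"
    using W(2) cinv_cmap[OF c] cmap_cinv[OF c] by (force simp: image_iff)
  then show ?thesis
    using continuous_open_preimage[OF continuous_on_cinv[OF c] open_chart_image[OF c] W(1)] by simp
qed

lemma transition_smooth:
  "c \<in> \<A> \<Longrightarrow> d \<in> \<A> \<Longrightarrow> smooth_on (cmap c ` (cdom c \<inter> cdom d)) (cmap d \<circ> cinv c)"
  using atlas by (simp add: smooth_atlas_def)

lemma transition_differentiable: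
  assumes "c \<in> \<A>" "d \<in> \<A>" "x \<in> cdom c" "x \<in> cdom d"
  shows "(cmap d \<circ> cinv c) differentiable (at (cmap c x))"
proof -
  have "Ck_on 1 (cmap c ` (cdom c \<inter> cdom d)) (cmap d \<circ> cinv c)"
    using transition_smooth[OF assms(1,2)] unfolding smooth_on_def by blast
  then show ?thesis using assms unfolding Ck_on_1 by blast
qed

text \<open>On the open overlap, \<open>\<phi> \<circ> cinv c\<close> is
  \<open>\<phi> \<circ> cinv d\<close> after the coordinate change. The codomain of \<phi> is left
  general because \<phi> will be a chart map \<open>cmap d\<close>, or such a map after
  \<open>h\<close>.\<close>

lemma has_derivative_chart_change:
  assumes c: "c \<in> \<A>" "x \<in> cdom c" and d: "d \<in> \<A>" "x \<in> cdom d"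
    and \<phi>: "(\<phi> \<circ> cinv d) differentiable (at (cmap d x))"
  shows "((\<phi> \<circ> cinv c) has_derivative
    (frechet_derivative (\<phi> \<circ> cinv d) (at (cmap d x)) \<circ> frechet_derivative (cmap d \<circ> cinv c) (at (cmap c x))))
    (at (cmap c x))"
proof (rule has_derivative_transform_within_open)
  show "open (cmap c ` (cdom c \<inter> cdom d))"
    using c d by (intro open_chart_image_subset open_Int open_cdom) auto
  show "cmap c x \<in> cmap c ` (cdom c \<inter> cdom d)" using c d by auto
  show "((\<phi> \<circ> cinv d) \<circ> (cmap d \<circ> cinv c)) y = (\<phi> \<circ> cinv c) y" if "y \<in> cmap c ` (cdom c \<inter> cdom d)" for y
    using that cinv_cmap[OF c(1)] cinv_cmap[OF d(1)] by auto
  have "((cmap d \<circ> cinv c) has_derivative frechet_derivative (cmap d \<circ> cinv c) (at (cmap c x))) (at (cmap c x))"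
    using transition_differentiable[OF c(1) d(1) c(2) d(2)] by (simp add: frechet_derivative_works)
  moreover have "((\<phi> \<circ> cinv d) has_derivative frechet_derivative (\<phi> \<circ> cinv d) (at (cmap d x)))
      (at ((cmap d \<circ> cinv c) (cmap c x)))"
    using \<phi> cinv_cmap[OF c] by (simp add: frechet_derivative_works)
  ultimately show "((\<phi> \<circ> cinv d \<circ> (cmap d \<circ> cinv c)) has_derivative
      (frechet_derivative (\<phi> \<circ> cinv d) (at (cmap d x)) \<circ> frechet_derivative (cmap d \<circ> cinv c) (at (cmap c x))))
      (at (cmap c x))"
    by (rule diff_chain_at)
qed

lemma frechet_derivative_chart_change:
  assumes "c \<in> \<A>" "x \<in> cdom c" "d \<in> \<A>" "x \<in> cdom d"
    and "(\<phi> \<circ> cinv d) differentiable (at (cmap d x))"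
  shows "frechet_derivative (\<phi> \<circ> cinv c) (at (cmap c x)) e =
    frechet_derivative (\<phi> \<circ> cinv d) (at (cmap d x)) (frechet_derivative (cmap d \<circ> cinv c) (at (cmap c x)) e)"
  using frechet_derivative_at[OF has_derivative_chart_change[OF assms]] by (metis o_apply)

lemma tvec_of_in_tangent_space:
  assumes c: "c \<in> \<A>" "x \<in> cdom c"
  shows "tvec_of \<A> c x e \<in> tangent_space \<A> x"
  using c by (auto simp: tangent_space_def tvec_of_def
      intro!: frechet_derivative_chart_change transition_differentiable)

lemma tvec_of_component:
  assumes c: "c \<in> \<A>" "x \<in> cdom c"
  shows "tvec_of \<A> c x e c = e"
proof -
  have "((\<lambda>y. y) has_derivative (\<lambda>y. y)) (at (cmap c x))" by (rule has_derivative_ident)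
  then have "((cmap c \<circ> cinv c) has_derivative (\<lambda>y. y)) (at (cmap c x))"
    by (rule has_derivative_transform_within_open[OF _ open_chart_image[OF c(1)]]) (use c cmap_cinv in auto)
  from frechet_derivative_at[OF this] show ?thesis using c by (simp add: tvec_of_def fun_eq_iff)
qed

lemma tangent_space_component:
  assumes "v \<in> tangent_space \<A> x" "c \<in> \<A>" "d \<in> \<A>" "x \<in> cdom c" "x \<in> cdom d"
  shows "v d = frechet_derivative (cmap d \<circ> cinv c) (at (cmap c x)) (v c)"
  using assms unfolding tangent_space_def by blast

lemma tangent_vector_eq_tvec_of:
  assumes "c \<in> \<A>" "x \<in> cdom c" "v \<in> tangent_space \<A> x"
  shows "v = tvec_of \<A> c x (v c)"
proof
  show "v d = tvec_of \<A> c x (v c) d" for d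
  proof (cases "d \<in> \<A> \<and> x \<in> cdom d")
    case True
    then show ?thesis
      using tangent_space_component[OF assms(3) assms(1) _ assms(2), of d] by (simp add: tvec_of_def)
  next
    \<comment> \<open>For charts not around \<open>x\<close> both sides carry the default entry 0,
      so equality holds as functions of all charts.\<close>
    case False
    then have "v d = 0" using assms(3) unfolding tangent_space_def by blast
    then show ?thesis using False by (simp only: tvec_of_def if_False)
  qed
qed

section \<open>Coordinate expressions of a C1 map and of its tangent map\<close>

context
  fixes W :: "'m set" and h :: "'m \<Rightarrow> 'm"
  assumes h: "Ck_map_on \<A> 1 W h" and W: "open W"
begin

lemma open_coordinate_domain:
  assumes "c \<in> \<A>" "d \<in> \<A>"
  shows "open (cmap c ` (cdom c \<inter> W \<inter> h -` cdom d))"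
proof (rule open_chart_image_subset)
  have "open (W \<inter> h -` cdom d)"
    using h W open_cdom[OF assms(2)] by (auto simp: Ck_map_on_def intro: continuous_open_preimage)
  then show "open (cdom c \<inter> W \<inter> h -` cdom d)"
    using open_cdom[OF assms(1)] by (auto simp: Int_assoc)
qed (use assms in auto)

lemma map_coordinates_C1:
  assumes "c \<in> \<A>" "d \<in> \<A>"
  shows "Ck_on 1 (cmap c ` (cdom c \<inter> W \<inter> h -` cdom d)) (cmap d \<circ> h \<circ> cinv c)"
  using h assms unfolding Ck_map_on_def by blast

lemma map_coordinates_differentiable:
  assumes "c \<in> \<A>" "d \<in> \<A>" "x \<in> cdom c" "x \<in> W" "h x \<in> cdom d"
  shows "(cmap d \<circ> h \<circ> cinv c) differentiable (at (cmap c x))"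
  using map_coordinates_C1[OF assms(1,2)] assms unfolding Ck_on_1 by blast

text \<open>Near each point, factor through a chart around its image under \<open>h\<close>. That
  chart changes with the point, so the argument is local.\<close>

lemma composition_C1:
  fixes \<phi> :: "'m \<Rightarrow> real"
  assumes c: "c \<in> \<A>" and \<phi>: "Ck_fun \<A> 1 \<phi>"
  shows "Ck_on 1 (cmap c ` (cdom c \<inter> W)) (\<phi> \<circ> h \<circ> cinv c)"
proof (rule Ck_on_1_local)
  fix y assume "y \<in> cmap c ` (cdom c \<inter> W)"
  then obtain x where x: "x \<in> cdom c" "x \<in> W" "y = cmap c x" by auto
  define d where "d = chart_at \<A> (h x)"
  have d: "d \<in> \<A>" "h x \<in> cdom d" using chart_at_in by (auto simp: d_def)
  let ?V = "cmap c ` (cdom c \<inter> W \<inter> h -` cdom d)"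
  have "Ck_on 1 ?V ((\<phi> \<circ> cinv d) \<circ> (cmap d \<circ> h \<circ> cinv c))"
  proof (rule Ck_on_1_compose[OF _ map_coordinates_C1[OF c d(1)]])
    show "Ck_on 1 (cmap d ` cdom d) (\<phi> \<circ> cinv d)" using \<phi> d(1) unfolding Ck_fun_def by blast
    show "(cmap d \<circ> h \<circ> cinv c) ` ?V \<subseteq> cmap d ` cdom d"
      using cinv_cmap[OF c] by auto
  qed
  then have "Ck_on 1 ?V (\<phi> \<circ> h \<circ> cinv c)"
    by (rule Ck_on_cong[OF _ open_coordinate_domain[OF c d(1)]]) (use cinv_cmap[OF c] cinv_cmap[OF d(1)] in auto)
  then show "\<exists>V. open V \<and> y \<in> V \<and> Ck_on 1 V (\<phi> \<circ> h \<circ> cinv c)"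
    using open_coordinate_domain[OF c d(1)] x d by (intro exI[of _ ?V]) auto
qed

lemma frechet_derivative_map_chart:
  assumes c: "c \<in> \<A>" "x \<in> cdom c" and x: "x \<in> W" and d: "d \<in> \<A>" "h x \<in> cdom d"
    and \<phi>: "(\<phi> \<circ> cinv d) differentiable (at (cmap d (h x)))"
  shows "frechet_derivative (\<phi> \<circ> h \<circ> cinv c) (at (cmap c x)) e =
    frechet_derivative (\<phi> \<circ> cinv d) (at (cmap d (h x)))
      (frechet_derivative (cmap d \<circ> h \<circ> cinv c) (at (cmap c x)) e)"
proof -
  let ?D = "frechet_derivative (\<phi> \<circ> cinv d) (at (cmap d (h x))) \<circ>
      frechet_derivative (cmap d \<circ> h \<circ> cinv c) (at (cmap c x))"
  have "((\<phi> \<circ> cinv d \<circ> (cmap d \<circ> h \<circ> cinv c)) has_derivative ?D) (at (cmap c x))"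
  proof (rule diff_chain_at)
    show "((cmap d \<circ> h \<circ> cinv c) has_derivative
        frechet_derivative (cmap d \<circ> h \<circ> cinv c) (at (cmap c x))) (at (cmap c x))"
      using map_coordinates_differentiable[OF c(1) d(1) c(2) x d(2)] by (simp add: frechet_derivative_works)
    show "((\<phi> \<circ> cinv d) has_derivative frechet_derivative (\<phi> \<circ> cinv d) (at (cmap d (h x))))
        (at ((cmap d \<circ> h \<circ> cinv c) (cmap c x)))"
      using \<phi> cinv_cmap[OF c] by (simp add: frechet_derivative_works)
  qed
  then have "((\<phi> \<circ> h \<circ> cinv c) has_derivative ?D) (at (cmap c x))"
    by (rule has_derivative_transform_within_open[OF _ open_coordinate_domain[OF c(1) d(1)]])
      (use c x d cinv_cmap[OF c(1)] cinv_cmap[OF d(1)] in auto)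
  from frechet_derivative_at[OF this] show ?thesis by (metis o_apply)
qed

text \<open>\<open>tangent_map\<close> reads its argument in an arbitrarily chosen chart. The choice
  is harmless: the component of \<open>v\<close> transforms by the same coordinate change that the
  chain rule produces for \<open>h\<close>.\<close>

lemma tangent_map_component:
  assumes c: "c \<in> \<A>" "x \<in> cdom c" and x: "x \<in> W" and d: "d \<in> \<A>" "h x \<in> cdom d"
    and v: "v \<in> tangent_space \<A> x"
  shows "tangent_map \<A> h x v d = frechet_derivative (cmap d \<circ> h \<circ> cinv c) (at (cmap c x)) (v c)"
proof -
  let ?c = "chart_at \<A> x"
  have "v ?c = frechet_derivative (cmap ?c \<circ> cinv c) (at (cmap c x)) (v c)"
    using v c chart_at_in[of x] by (intro tangent_space_component)
  moreover have "frechet_derivative (cmap d \<circ> h \<circ> cinv c) (at (cmap c x)) (v c) =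
      frechet_derivative (cmap d \<circ> h \<circ> cinv ?c) (at (cmap ?c x))
        (frechet_derivative (cmap ?c \<circ> cinv c) (at (cmap c x)) (v c))"
    using c chart_at_in[of x] x d
    by (intro frechet_derivative_chart_change map_coordinates_differentiable)
  ultimately show ?thesis using d by (simp add: tangent_map_def Let_def)
qed

lemma tangent_map_in_tangent_space:
  assumes x: "x \<in> W" and v: "v \<in> tangent_space \<A> x"
  shows "tangent_map \<A> h x v \<in> tangent_space \<A> (h x)"
  unfolding tangent_space_def
proof (intro CollectI conjI ballI impI allI)
  let ?c = "chart_at \<A> x"
  fix d d' assume d: "d \<in> \<A>" "d' \<in> \<A>" "h x \<in> cdom d \<inter> cdom d'"
  then show "tangent_map \<A> h x v d' =
      frechet_derivative (cmap d' \<circ> cinv d) (at (cmap d (h x))) (tangent_map \<A> h x v d)"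
    using frechet_derivative_map_chart[OF chart_at_in x d(1), of "cmap d'" "v ?c"]
      transition_differentiable[OF d(1,2)] tangent_map_component[OF chart_at_in x _ _ v] by simp
qed (auto simp: tangent_map_def)

text \<open>The chain rule df(Th v) = d(f o h)(v), freed from the charts chosen inside the
  definitions: the source chart \<open>c\<close> is arbitrary.\<close>

lemma differential_tangent_map:
  assumes c: "c \<in> \<A>" "x \<in> cdom c" and x: "x \<in> W" and f: "Ck_fun \<A> 1 f"
    and v: "v \<in> tangent_space \<A> x"
  shows "differential \<A> f (h x) (tangent_map \<A> h x v) =
    frechet_derivative (f \<circ> h \<circ> cinv c) (at (cmap c x)) (v c)"
proof -
  let ?d = "chart_at \<A> (h x)"
  have "Ck_on 1 (cmap ?d ` cdom ?d) (f \<circ> cinv ?d)"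
    using f chart_at_in unfolding Ck_fun_def by blast
  then have "(f \<circ> cinv ?d) differentiable (at (cmap ?d (h x)))"
    using chart_at_in unfolding Ck_on_1 by blast
  then show ?thesis
    using frechet_derivative_map_chart[OF c x chart_at_in, of f] tangent_map_component[OF c x chart_at_in v]
    by (simp add: differential_def Let_def)
qed

end

end

section \<open>The operator norm of a tangent map\<close>

text \<open>\<open>m\<close> is the minimum of the quadratic form on the compact unit sphere;
  homogeneity of degree 2 carries the bound to all vectors.\<close>

lemma bilinear_positive_lower_bound:
  fixes q :: "'e::euclidean_space \<Rightarrow> 'e \<Rightarrow> real"
  assumes q: "bilinear q" and pos: "\<And>a. a \<noteq> 0 \<Longrightarrow> q a a > 0"
  obtains m where "m > 0" "\<And>a. m * (norm a)\<^sup>2 \<le> q a a"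
proof -
  have "continuous_on (sphere 0 1) (\<lambda>a. q a a)"
    by (intro bilinear_continuous_on_compose[OF _ _ q] continuous_intros)
  moreover have "sphere (0::'e) 1 \<noteq> {}" by (simp add: sphere_eq_empty)
  ultimately obtain z where z: "norm z = 1" "\<And>a. norm a = 1 \<Longrightarrow> q z z \<le> q a a"
    using continuous_attains_inf[of "sphere 0 1" "\<lambda>a. q a a"] by auto
  have "q z z * (norm a)\<^sup>2 \<le> q a a" for a
  proof (cases "a = 0")
    case False
    have "a = norm a *\<^sub>R (a /\<^sub>R norm a)" using False by simp
    then have "q a a = (norm a)\<^sup>2 * q (a /\<^sub>R norm a) (a /\<^sub>R norm a)"
      using bilinear_lmul[OF q] bilinear_rmul[OF q] by (metis power2_eq_square mult.assoc real_scaleR_def)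
    then show ?thesis
      using z(2)[of "a /\<^sub>R norm a"] False by (simp add: mult.commute)
  qed (simp add: bilinear_lzero[OF q])
  moreover have "q z z > 0" using z(1) by (intro pos) auto
  ultimately show thesis using that by blast
qed

context
  fixes \<A> :: "('m::{second_countable_topology,t2_space}, 'e::euclidean_space) chart set"
    and g :: "'m \<Rightarrow> ('m, 'e) tvec \<Rightarrow> ('m, 'e) tvec \<Rightarrow> real"
  assumes riem: "riemannian_manifold \<A> g"
begin

lemma riemannian_atlas: "smooth_atlas \<A>"
  using riem by (simp add: riemannian_manifold_def)

lemma metric_bilinear:
  "c \<in> \<A> \<Longrightarrow> x \<in> cdom c \<Longrightarrow> bilinear (\<lambda>a b. g x (tvec_of \<A> c x a) (tvec_of \<A> c x b))"
  using riem unfolding riemannian_manifold_def by blast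

lemma metric_coordinates_pos:
  assumes c: "c \<in> \<A>" "x \<in> cdom c" and a: "a \<noteq> 0"
  shows "g x (tvec_of \<A> c x a) (tvec_of \<A> c x a) > 0"
proof -
  have "tvec_of \<A> c x a \<noteq> (\<lambda>c. 0)"
    using tvec_of_component[OF riemannian_atlas c, of a] a by (metis (full_types))
  then show ?thesis
    using riem tvec_of_in_tangent_space[OF riemannian_atlas c] unfolding riemannian_manifold_def by blast
qed

text \<open>\<open>sqrt\<close> of a negative number is negative, so the sign of the metric matters.
  Positivity is assumed for nonzero vectors; the zero vector is covered by bilinearity in a
  chart.\<close>

lemma tnorm_nonneg:
  assumes "v \<in> tangent_space \<A> x"
  shows "tnorm g x v \<ge> 0"
proof -
  let ?c = "chart_at \<A> x"
  note c = chart_at_in[OF riemannian_atlas, of x]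
  have "g x (tvec_of \<A> ?c x (v ?c)) (tvec_of \<A> ?c x (v ?c)) \<ge> 0"
    using metric_coordinates_pos[OF c, of "v ?c"] bilinear_lzero[OF metric_bilinear[OF c]]
    by (cases "v ?c = 0") (auto intro: less_imp_le)
  then show ?thesis
    using tangent_vector_eq_tvec_of[OF riemannian_atlas c assms] by (simp add: tnorm_def)
qed

lemma tnorm_scaleR:
  assumes c: "c \<in> \<A>" "x \<in> cdom c"
  shows "tnorm g x (tvec_of \<A> c x (r *\<^sub>R a)) = \<bar>r\<bar> * tnorm g x (tvec_of \<A> c x a)"
proof -
  have "g x (tvec_of \<A> c x (r *\<^sub>R a)) (tvec_of \<A> c x (r *\<^sub>R a)) =
      r\<^sup>2 * g x (tvec_of \<A> c x a) (tvec_of \<A> c x a)"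
    using bilinear_lmul[OF metric_bilinear[OF c]] bilinear_rmul[OF metric_bilinear[OF c]]
    by (simp add: power2_eq_square)
  then show ?thesis by (simp add: tnorm_def real_sqrt_mult)
qed

lemma tnorm_bounded_on_compact:
  assumes c: "c \<in> \<A>" and K: "compact K" "K \<subseteq> cmap c ` cdom c"
  obtains B where "B > 0" "\<And>y. y \<in> K \<Longrightarrow> tnorm g (cinv c y) (tvec_of \<A> c (cinv c y) e) \<le> B"
proof -
  let ?n = "\<lambda>y. tnorm g (cinv c y) (tvec_of \<A> c (cinv c y) e)"
  have "smooth_on (cmap c ` cdom c) (\<lambda>y. g (cinv c y) (tvec_of \<A> c (cinv c y) e) (tvec_of \<A> c (cinv c y) e))"
    using riem c unfolding riemannian_manifold_def by blast
  then have "Ck_on 0 (cmap c ` cdom c) (\<lambda>y. g (cinv c y) (tvec_of \<A> c (cinv c y) e) (tvec_of \<A> c (cinv c y) e))"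
    unfolding smooth_on_def by blast
  then have "continuous_on K ?n"
    unfolding tnorm_def Ck_on.simps by (intro continuous_on_real_sqrt) (rule continuous_on_subset[OF _ K(2)])
  then have "bounded (?n ` K)"
    using K(1) by (intro compact_imp_bounded compact_continuous_image)
  then show thesis
    using that unfolding bounded_pos by fastforce
qed

text \<open>Normalise \<open>v\<close> and compare with the supremum. The content lies in showing
  that the supremum is over a bounded set, by comparing both metrics with Euclidean norms in
  coordinates.\<close>

lemma tnorm_tangent_map_le:
  assumes h: "Ck_map_on \<A> 1 W h" and W: "open W" and x: "x \<in> W" and v: "v \<in> tangent_space \<A> x"
  shows "tnorm g (h x) (tangent_map \<A> h x v) \<le>
    tangent_opnorm \<A> g x (h x) (tangent_map \<A> h x) * tnorm g x v"
proof -
  define c where "c = chart_at \<A> x"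
  define d where "d = chart_at \<A> (h x)"
  note atlas = riemannian_atlas
  have c: "c \<in> \<A>" "x \<in> cdom c" and d: "d \<in> \<A>" "h x \<in> cdom d"
    using chart_at_in[OF atlas] by (auto simp: c_def d_def)
  define T where "T = frechet_derivative (cmap d \<circ> h \<circ> cinv c) (at (cmap c x))"
  have linT: "linear T"
    unfolding T_def
    by (rule linear_frechet_derivative[OF map_coordinates_differentiable[OF atlas h W c(1) d(1) c(2) x d(2)]])
  define n where "n a = tnorm g x (tvec_of \<A> c x a)" for a
  define n' where "n' a = tnorm g (h x) (tvec_of \<A> d (h x) a)" for a
  have tm: "tangent_map \<A> h x w = tvec_of \<A> d (h x) (T (w c))" if "w \<in> tangent_space \<A> x" for w
    using tangent_vector_eq_tvec_of[OF atlas d tangent_map_in_tangent_space[OF atlas h W x that]]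
      tangent_map_component[OF atlas h W c x d that] by (simp add: T_def)
  have n'T: "tnorm g (h x) (tangent_map \<A> h x w) = n' (T (w c))" if "w \<in> tangent_space \<A> x" for w
    by (simp add: tm[OF that] n'_def)
  have n_eq: "tnorm g x w = n (w c)" if "w \<in> tangent_space \<A> x" for w
    using tangent_vector_eq_tvec_of[OF atlas c that] by (simp add: n_def)
  obtain m where m: "m > 0" "\<And>a. m * (norm a)\<^sup>2 \<le> g x (tvec_of \<A> c x a) (tvec_of \<A> c x a)"
    using bilinear_positive_lower_bound[OF metric_bilinear[OF c] metric_coordinates_pos[OF c]] by metis
  obtain M where M: "M > 0" "\<And>a b. norm (g (h x) (tvec_of \<A> d (h x) a) (tvec_of \<A> d (h x) b)) \<le> M * norm a * norm b"
    using bilinear_bounded_pos[OF metric_bilinear[OF d]] by blast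
  obtain B where B: "B > 0" "\<And>a. norm (T a) \<le> B * norm a"
    using linear_bounded_pos[OF linT] by blast
  \<comment> \<open>A real \<open>SUP\<close> bounds its members only if they are bounded above. On
    the unit ball |w|^2 \<le> 1/m, and the squared norm of the image is at most M (B |w|)^2; this
    gives the constant M B^2 / m.\<close>
  have bdd: "bdd_above ((\<lambda>w. tnorm g (h x) (tangent_map \<A> h x w)) ` {w \<in> tangent_space \<A> x. tnorm g x w \<le> 1})"
  proof (rule bdd_aboveI2)
    fix w assume "w \<in> {w \<in> tangent_space \<A> x. tnorm g x w \<le> 1}"
    then have w: "w \<in> tangent_space \<A> x" "n (w c) \<le> 1" using n_eq by auto
    have "m * (norm (w c))\<^sup>2 \<le> 1"
      using w(2) order_trans[OF m(2)[of "w c"]] by (simp add: n_def tnorm_def)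
    then have wc: "(norm (w c))\<^sup>2 \<le> 1 / m" using m(1) by (simp add: field_simps)
    have "g (h x) (tvec_of \<A> d (h x) (T (w c))) (tvec_of \<A> d (h x) (T (w c))) \<le> M * norm (T (w c)) * norm (T (w c))"
      using M(2)[of "T (w c)" "T (w c)"] by simp
    also have "\<dots> = M * (norm (T (w c)))\<^sup>2" by (simp add: power2_eq_square)
    also have "\<dots> \<le> M * (B * norm (w c))\<^sup>2"
      using M(1) B by (intro mult_left_mono power_mono) auto
    also have "\<dots> = M * B\<^sup>2 * (norm (w c))\<^sup>2" by (simp add: power_mult_distrib)
    also have "\<dots> \<le> M * B\<^sup>2 * (1 / m)"
      using M(1) wc by (intro mult_left_mono) auto
    finally show "tnorm g (h x) (tangent_map \<A> h x w) \<le> sqrt (M * B\<^sup>2 * (1 / m))"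
      unfolding tm[OF w(1)] tnorm_def by (rule real_sqrt_le_mono)
  qed
  show ?thesis
  \<comment> \<open>The zero vector cannot be normalised, but both sides vanish for it.\<close>
  proof (cases "v c = 0")
    case True
    have "n' (T (v c)) = 0" "n (v c) = 0"
      using True tnorm_scaleR[OF c, of 0 0] tnorm_scaleR[OF d, of 0 0] linear_0[OF linT]
      by (simp_all add: n_def n'_def)
    then show ?thesis by (simp add: n_eq[OF v] n'T[OF v])
  next
    case False
    have npos: "n (v c) > 0"
      using metric_coordinates_pos[OF c False] by (simp add: n_def tnorm_def)
    define w where "w = tvec_of \<A> c x ((1 / n (v c)) *\<^sub>R v c)"
    have w: "w \<in> tangent_space \<A> x" "w c = (1 / n (v c)) *\<^sub>R v c"
      using tvec_of_in_tangent_space[OF atlas c] tvec_of_component[OF atlas c] by (auto simp: w_def)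
    have "n (w c) = 1"
      using npos tnorm_scaleR[OF c, of "1 / n (v c)" "v c"] by (simp add: w(2) n_def)
    then have "tnorm g (h x) (tangent_map \<A> h x w) \<le> tangent_opnorm \<A> g x (h x) (tangent_map \<A> h x)"
      unfolding tangent_opnorm_def by (intro cSUP_upper[OF _ bdd]) (simp add: w n_eq[OF w(1)])
    moreover have "n' (T (w c)) = n' (T (v c)) / n (v c)"
      using npos tnorm_scaleR[OF d, of "1 / n (v c)" "T (v c)"]
      by (simp add: w(2) n'_def linear_scale[OF linT])
    ultimately show ?thesis
      using npos by (simp add: n_eq[OF v] n'T[OF v] n'T[OF w(1)] field_simps)
  qed
qed

end

section \<open>Flows\<close>

context
  fixes \<A> :: "('m::{second_countable_topology,t2_space}, 'e::euclidean_space) chart set"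
  assumes atlas: "smooth_atlas \<A>"
begin

text \<open>The image of the chart is open, so the line stays in it for parameters slightly outside
  [0,1]; this is the required extension. In another chart the path is a transition map along a
  line.\<close>

lemma segment_smooth_1_simplex:
  assumes c: "c \<in> \<A>" and seg: "closed_segment y z \<subseteq> cmap c ` cdom c"
  shows "smooth_1_simplex \<A> (\<lambda>s. cinv c (y + s *\<^sub>R (z - y)))"
proof -
  let ?S = "cmap c ` cdom c" and ?l = "\<lambda>s::real. y + s *\<^sub>R (z - y)"
  let ?U = "{s. ?l s \<in> ?S}"
  have "open ?U"
    using open_chart_image[OF atlas c]
    by (intro continuous_open_vimage[unfolded vimage_def]) (auto intro!: continuous_intros)
  moreover have "{0..1} \<subseteq> ?U"
    using seg closed_segment_eq_image_line[of y "z - y"] by auto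
  moreover have "continuous_on ?U (\<lambda>s. cinv c (?l s))"
    by (rule continuous_on_compose2[OF continuous_on_cinv[OF atlas c]]) (auto intro!: continuous_intros)
  moreover have "smooth_on (?U \<inter> (\<lambda>s. cinv c (?l s)) -` cdom d) (cmap d \<circ> (\<lambda>s. cinv c (?l s)))"
    if d: "d \<in> \<A>" for d
  proof -
    let ?V = "cmap c ` (cdom c \<inter> cdom d)"
    have "?U \<inter> (\<lambda>s. cinv c (?l s)) -` cdom d = {s. ?l s \<in> ?V}"
    proof (intro set_eqI iffI)
      fix s assume s: "s \<in> ?U \<inter> (\<lambda>s. cinv c (?l s)) -` cdom d"
      then have "?l s = cmap c (cinv c (?l s))" "cinv c (?l s) \<in> cdom c \<inter> cdom d"
        using cmap_cinv[OF atlas c] cinv_in_cdom[OF atlas c] by auto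
      then show "s \<in> {s. ?l s \<in> ?V}" by (metis (mono_tags, lifting) image_eqI mem_Collect_eq)
    next
      fix s assume "s \<in> {s. ?l s \<in> ?V}"
      then obtain x where "?l s = cmap c x" "x \<in> cdom c" "x \<in> cdom d" by auto
      then show "s \<in> ?U \<inter> (\<lambda>s. cinv c (?l s)) -` cdom d"
        using cinv_cmap[OF atlas c] by simp
    qed
    moreover have "open ?V"
      using c d by (intro open_chart_image_subset[OF atlas] open_Int open_cdom[OF atlas]) auto
    ultimately show ?thesis
      using transition_smooth[OF atlas c d] Ck_on_compose_line[of _ ?V "cmap d \<circ> cinv c" y "z - y" 1]
      by (auto simp: smooth_on_def o_def)
  qed
  ultimately show ?thesis unfolding smooth_1_simplex_def by blast
qed

text \<open>The quantifier over the points of the segment stands inside the almost sure statement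
  because the explosion time of a compact set is an infimum over its points.\<close>

lemma survival_on_segment:
  assumes "strongly_1_complete \<A> P \<xi>" and c: "c \<in> \<A>" and seg: "closed_segment y z \<subseteq> cmap c ` cdom c"
  shows "AE \<omega> in P. \<forall>w\<in>closed_segment y z. ennreal t < \<xi> (cinv c w) \<omega>"
proof -
  have img: "(\<lambda>s. cinv c (y + s *\<^sub>R (z - y))) ` {0..1} = cinv c ` closed_segment y z"
    using closed_segment_eq_image_line[of y "z - y"] by (simp add: image_image)
  have "AE \<omega> in P. explosion_time_on \<xi> (cinv c ` closed_segment y z) \<omega> = \<infinity>"
    using assms(1) segment_smooth_1_simplex[OF c seg] unfolding strongly_1_complete_def img[symmetric] by blast
  then show ?thesis
  proof eventually_elim
    case (elim \<omega>)
    show ?case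
    proof
      fix w assume "w \<in> closed_segment y z"
      then have "explosion_time_on \<xi> (cinv c ` closed_segment y z) \<omega> \<le> \<xi> (cinv c w) \<omega>"
        unfolding explosion_time_on_def by (intro INF_lower) auto
      then show "ennreal t < \<xi> (cinv c w) \<omega>" using elim by (simp add: top.extremum_unique)
    qed
  qed
qed

lemma Ck_fun_1_continuous:
  assumes "Ck_fun \<A> 1 f"
  shows "continuous_on UNIV f"
proof (rule continuous_at_imp_continuous_on, rule ballI)
  fix x
  let ?c = "chart_at \<A> x"
  note c = chart_at_in[OF atlas, of x]
  have "continuous_on (cmap ?c ` cdom ?c) (f \<circ> cinv ?c)"
    using assms c(1) Ck_on_1_imp_continuous_on unfolding Ck_fun_def by blast
  then have "continuous_on (cdom ?c) (\<lambda>x. (f \<circ> cinv ?c) (cmap ?c x))"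
    by (rule continuous_on_compose2[OF _ continuous_on_cmap[OF atlas c(1)]]) auto
  then have "continuous_on (cdom ?c) f"
    using cinv_cmap[OF atlas c(1)] by (simp cong: continuous_on_cong)
  then show "isCont f x"
    using c open_cdom[OF atlas c(1)] by (simp add: continuous_on_eq_continuous_at)
qed

end

text \<open>The solution at time \<open>t\<close> is measurable only on the event of survival. That
  event lies in the \<sigma>-algebra of time \<open>t\<close> since \<zeta> is a stopping time, so
  extension by 0 stays measurable.\<close>

lemma borel_measurable_sde_solution:
  fixes f :: "'m::topological_space \<Rightarrow> real"
  assumes \<F>: "usual_filtered_space P \<F>" and sol: "sde_solution \<A> P \<F> B X A x0 x \<zeta>"
    and f: "continuous_on UNIV f" and t: "t \<ge> 0"
  shows "(\<lambda>\<omega>. f (x t \<omega>) * indicator {\<omega>. ennreal t < \<zeta> \<omega>} \<omega>) \<in> borel_measurable P"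
proof -
  let ?Ft = "\<F> (ennreal t)" and ?\<Omega> = "{\<omega> \<in> space P. ennreal t < \<zeta> \<omega>}"
  have sp: "space ?Ft = space P"
    using \<F> by (simp add: usual_filtered_space_def filtration.space_F)
  have "\<forall>t. sets (\<F> t) \<subseteq> sets P"
    using \<F> unfolding usual_filtered_space_def by (elim conjE)
  then have sub: "sets ?Ft \<subseteq> sets P" ..
  have "Measurable.pred ?Ft (\<lambda>\<omega>. \<zeta> \<omega> \<le> ennreal t)"
    using sol by (intro stopping_timeD) (simp add: sde_solution_def)
  then have "Measurable.pred ?Ft (\<lambda>\<omega>. \<not> \<zeta> \<omega> \<le> ennreal t)" by simp
  then have \<Omega>: "?\<Omega> \<inter> space ?Ft \<in> sets ?Ft"
    by (simp add: pred_def sp not_le Int_absorb2 subset_iff)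
  have "x t \<in> borel_measurable (restrict_space ?Ft ?\<Omega>)"
    using sol t unfolding sde_solution_def by blast
  then have "(\<lambda>\<omega>. f (x t \<omega>)) \<in> borel_measurable (restrict_space ?Ft ?\<Omega>)"
    by (rule measurable_compose[OF _ borel_measurable_continuous_onI[OF f]])
  then have "(\<lambda>\<omega>. indicator ?\<Omega> \<omega> *\<^sub>R f (x t \<omega>)) \<in> borel_measurable ?Ft"
    by (rule borel_measurable_restrict_space_iff[OF \<Omega>, THEN iffD1])
  then have "(\<lambda>\<omega>. indicator ?\<Omega> \<omega> *\<^sub>R f (x t \<omega>)) \<in> borel_measurable P"
    by (rule borel_measurable_subalgebra[OF sub sp])
  then show ?thesis
    by (rule measurable_cong[THEN iffD1, rotated]) (auto simp: indicator_def)
qed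

text \<open>The maximal solutions pin down \<open>F\<^sub>0\<close> only pointwise almost surely; continuity of the partial
  flow and a countable dense set give one null set for all starting points.\<close>

lemma partial_flow_0:
  fixes F :: "real \<Rightarrow> 'm::{second_countable_topology,t2_space} \<Rightarrow> 'w \<Rightarrow> 'm"
  assumes flow: "partial_flow \<A> P F \<xi>" and start: "\<And>x. AE \<omega> in P. F 0 x \<omega> = x"
  shows "AE \<omega> in P. \<forall>x\<in>flow_domain \<xi> 0 \<omega>. F 0 x \<omega> = x"
proof -
  obtain D :: "'m set" where D: "countable D" "\<And>U. open U \<Longrightarrow> U \<noteq> {} \<Longrightarrow> \<exists>d\<in>D. d \<in> U"
    by (rule countable_dense_setE) blast
  have "AE \<omega> in P. \<forall>d\<in>D. F 0 d \<omega> = d"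
    using D(1) start by (intro AE_ball_countable') auto
  with flow[unfolded partial_flow_def] show ?thesis
  proof eventually_elim
    case (elim \<omega>)
    let ?W = "flow_domain \<xi> 0 \<omega>"
    have W: "open ?W" and C1: "C1_diffeo_onto_open \<A> ?W (\<lambda>x. F 0 x \<omega>)"
      using elim(1) by (metis order_refl)+
    then have cont: "continuous_on ?W (\<lambda>x. F 0 x \<omega>)"
      by (simp add: C1_diffeo_onto_open_def Ck_map_on_def)
    show ?case
    proof (rule ballI, rule ccontr)
      fix x assume x: "x \<in> ?W" and ne: "F 0 x \<omega> \<noteq> x"
      obtain U V where UV: "open U" "open V" "F 0 x \<omega> \<in> U" "x \<in> V" "U \<inter> V = {}"
        using hausdorff[OF ne] by blast
      have "open (V \<inter> (?W \<inter> (\<lambda>x. F 0 x \<omega>) -` U))"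
        using UV by (intro open_Int continuous_open_preimage[OF cont W])
      then obtain d where "d \<in> D" "d \<in> V \<inter> (?W \<inter> (\<lambda>x. F 0 x \<omega>) -` U)"
        using D(2)[of "V \<inter> (?W \<inter> (\<lambda>x. F 0 x \<omega>) -` U)"] UV x by blast
      then show False using elim(2) UV(5) by auto
    qed
  qed
qed

text \<open>The integrand of \<open>diffusion_semigroup\<close> as a function of chart coordinates;
  it plays the role of \<open>u\<close> in \<open>random_C1_function\<close>.\<close>

definition coordinate_payoff ::
  "('m \<Rightarrow> real) \<Rightarrow> (real \<Rightarrow> 'm \<Rightarrow> 'w \<Rightarrow> 'm) \<Rightarrow> ('m \<Rightarrow> 'w \<Rightarrow> ennreal) \<Rightarrow> real \<Rightarrow> ('m, 'e) chart \<Rightarrow>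
   'e \<Rightarrow> 'w \<Rightarrow> real" where
  "coordinate_payoff f F \<xi> t c y \<omega> =
     f (F t (cinv c y) \<omega>) * indicator {\<omega>. ennreal t < \<xi> (cinv c y) \<omega>} \<omega>"

section \<open>The payoff for one fixed \<omega>\<close>

context
  fixes \<A> :: "('m::{second_countable_topology,t2_space}, 'e::euclidean_space) chart set"
    and F :: "real \<Rightarrow> 'm \<Rightarrow> 'w \<Rightarrow> 'm" and \<xi> :: "'m \<Rightarrow> 'w \<Rightarrow> ennreal" and t :: real and \<omega> :: 'w
    and f :: "'m \<Rightarrow> real"
  assumes atlas: "smooth_atlas \<A>" and f: "Ck_fun \<A> 1 f"
    and W: "open (flow_domain \<xi> t \<omega>)"
    and C1: "Ck_map_on \<A> 1 (flow_domain \<xi> t \<omega>) (\<lambda>x. F t x \<omega>)"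
begin

lemma open_payoff_domain:
  assumes c: "c \<in> \<A>"
  shows "open (cmap c ` (cdom c \<inter> flow_domain \<xi> t \<omega>))"
  using W open_cdom[OF atlas c] by (intro open_chart_image_subset[OF atlas c]) auto

lemma coordinate_payoff_eq:
  assumes c: "c \<in> \<A>" and y: "y \<in> cmap c ` (cdom c \<inter> flow_domain \<xi> t \<omega>)"
  shows "coordinate_payoff f F \<xi> t c y \<omega> = (f \<circ> (\<lambda>x. F t x \<omega>) \<circ> cinv c) y"
  using y cinv_cmap[OF atlas c] by (auto simp: coordinate_payoff_def flow_domain_def)

text \<open>On the open set of surviving starting points the indicator is constantly 1 and does not
  spoil differentiability.\<close>

lemma coordinate_payoff_C1:
  assumes c: "c \<in> \<A>"
  shows "Ck_on 1 (cmap c ` (cdom c \<inter> flow_domain \<xi> t \<omega>)) (\<lambda>y. coordinate_payoff f F \<xi> t c y \<omega>)"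
  by (rule Ck_on_cong[OF composition_C1[OF atlas C1 W c f] open_payoff_domain[OF c]])
    (simp only: coordinate_payoff_eq[OF c])

lemma frechet_derivative_coordinate_payoff:
  assumes c: "c \<in> \<A>" "x \<in> cdom c" and x: "x \<in> flow_domain \<xi> t \<omega>" and v: "v \<in> tangent_space \<A> x"
  shows "frechet_derivative (\<lambda>y. coordinate_payoff f F \<xi> t c y \<omega>) (at (cmap c x)) (v c) =
    differential \<A> f (F t x \<omega>) (tangent_map \<A> (\<lambda>y. F t y \<omega>) x v)"
proof -
  have xc: "cmap c x \<in> cmap c ` (cdom c \<inter> flow_domain \<xi> t \<omega>)" using c x by auto
  have "(\<lambda>y. coordinate_payoff f F \<xi> t c y \<omega>) differentiable (at (cmap c x))"
    using coordinate_payoff_C1[OF c(1)] xc unfolding Ck_on_1 by blast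
  then have "frechet_derivative (\<lambda>y. coordinate_payoff f F \<xi> t c y \<omega>) (at (cmap c x)) =
      frechet_derivative (f \<circ> (\<lambda>x. F t x \<omega>) \<circ> cinv c) (at (cmap c x))"
    by (rule frechet_derivative_transform_within_open[OF _ open_payoff_domain[OF c(1)] xc])
      (simp only: coordinate_payoff_eq[OF c(1)])
  then show ?thesis
    using differential_tangent_map[OF atlas C1 W c x f v] by simp
qed

end

section \<open>Differentiating the semigroup\<close>

context
  fixes \<A> :: "('m::{second_countable_topology,t2_space}, 'e::euclidean_space) chart set"
    and g :: "'m \<Rightarrow> ('m, 'e) tvec \<Rightarrow> ('m, 'e) tvec \<Rightarrow> real"
    and P :: "'w measure" and \<F> :: "ennreal \<Rightarrow> 'w measure"
    and B :: "real \<Rightarrow> 'w \<Rightarrow> 'b::euclidean_space"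
    and X :: "'m \<Rightarrow> 'b \<Rightarrow> ('m, 'e) tvec" and A :: "'m \<Rightarrow> ('m, 'e) tvec"
    and F :: "real \<Rightarrow> 'm \<Rightarrow> 'w \<Rightarrow> 'm" and \<xi> :: "'m \<Rightarrow> 'w \<Rightarrow> ennreal"
    and f :: "'m \<Rightarrow> real" and t C :: real
  assumes riem: "riemannian_manifold \<A> g"
    and \<F>: "usual_filtered_space P \<F>"
    and sol: "\<And>x. sde_solution \<A> P \<F> B X A x (\<lambda>s. F s x) (\<xi> x)"
    and flow: "partial_flow \<A> P F \<xi>"
    and complete: "strongly_1_complete \<A> P \<xi>"
    and f: "Ck_fun \<A> 1 f" and f_bounded: "\<And>x. \<bar>f x\<bar> \<le> C"
    and t: "t \<ge> 0"
begin

private abbreviation W :: "'w \<Rightarrow> 'm set" where "W \<equiv> flow_domain \<xi> t"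

private abbreviation u :: "('m, 'e) chart \<Rightarrow> 'e \<Rightarrow> 'w \<Rightarrow> real" where
  "u \<equiv> coordinate_payoff f F \<xi> t"

private lemmas atlas = riemannian_atlas[OF riem]

lemma flow_regular_AE:
  "AE \<omega> in P. open (W \<omega>) \<and> Ck_map_on \<A> 1 (W \<omega>) (\<lambda>x. F t x \<omega>)"
  using flow[unfolded partial_flow_def]
proof eventually_elim
  case (elim \<omega>)
  from elim[THEN conjunct1, rule_format, OF t] show ?case by (simp add: C1_diffeo_onto_open_def)
qed

text \<open>A constant path is a smooth simplex, so strong 1-completeness includes non-explosion
  from each single point.\<close>

lemma flow_regular_at_AE:
  "AE \<omega> in P. open (W \<omega>) \<and> Ck_map_on \<A> 1 (W \<omega>) (\<lambda>x. F t x \<omega>) \<and> x \<in> W \<omega>"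
proof -
  note c = chart_at_in[OF atlas, of x]
  have "AE \<omega> in P. \<forall>w\<in>closed_segment (cmap (chart_at \<A> x) x) (cmap (chart_at \<A> x) x).
      ennreal t < \<xi> (cinv (chart_at \<A> x) w) \<omega>"
    using c by (intro survival_on_segment[OF atlas complete]) auto
  with flow_regular_AE show ?thesis
    by eventually_elim (simp add: cinv_cmap[OF atlas c] flow_domain_def)
qed

lemma random_C1_coordinate_payoff:
  assumes c: "c \<in> \<A>"
  shows "random_C1_function P (cmap c ` cdom c) (u c) C"
proof (intro random_C1_function.intro random_C1_function_axioms.intro)
  show "prob_space P" "complete_measure P" using \<F> by (simp_all add: usual_filtered_space_def)
  show "open (cmap c ` cdom c)" by (rule open_chart_image[OF atlas c])
  show "u c y \<in> borel_measurable P" for y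
    using borel_measurable_sde_solution[OF \<F> sol Ck_fun_1_continuous[OF atlas f] t, of "cinv c y"]
    by (simp add: coordinate_payoff_def[abs_def])
  show "\<bar>u c y \<omega>\<bar> \<le> C" for y \<omega>
    using f_bounded[of "F t (cinv c y) \<omega>"] order_trans[OF abs_ge_zero f_bounded] by (simp add: coordinate_payoff_def indicator_def)
  show "AE \<omega> in P. \<exists>V. open V \<and> closed_segment y z \<subseteq> V \<and> Ck_on 1 V (\<lambda>y. u c y \<omega>)"
    if seg: "closed_segment y z \<subseteq> cmap c ` cdom c" for y z
    using flow_regular_AE survival_on_segment[OF atlas complete c seg, of t]
  proof eventually_elim
    case (elim \<omega>)
    \<comment> \<open>The chart image of the surviving points is the neighbourhood \<open>V\<close>;
      it is random, as the locale allows.\<close>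
    have "closed_segment y z \<subseteq> cmap c ` (cdom c \<inter> W \<omega>)"
    proof
      fix w assume w: "w \<in> closed_segment y z"
      then have "w = cmap c (cinv c w)" "cinv c w \<in> cdom c"
        using seg cmap_cinv[OF atlas c] cinv_in_cdom[OF atlas c] by auto
      moreover have "cinv c w \<in> W \<omega>" using elim(2) w by (simp add: flow_domain_def)
      ultimately show "w \<in> cmap c ` (cdom c \<inter> W \<omega>)" by blast
    qed
    then show ?case
      using elim(1) open_payoff_domain[where F = F and t = t and \<omega> = \<omega> and \<xi> = \<xi>, OF atlas f _ _ c]
        coordinate_payoff_C1[where F = F and t = t and \<omega> = \<omega> and \<xi> = \<xi>, OF atlas f _ _ c] by blast
  qed
qed

text \<open>|df(TF v)| is at most a multiple of |TF| |v|, and a vector field with constant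
  components \<open>e\<close> in the chart has bounded Riemannian norm over a compact set. The flow
  moment thus dominates that of \<open>G\<close>.\<close>

lemma derivative_moment_pos_time:
  assumes c: "c \<in> \<A>" and K: "compact K" "K \<subseteq> cmap c ` cdom c" and df: "bounded_one_form \<A> g (differential \<A> f)"
    and moment: "\<exists>\<delta>>0. (SUP x\<in>cinv c ` K. flow_moment \<A> g P F \<xi> (1 + \<delta>) t x) < \<infinity>"
  shows "\<exists>\<delta>>0. \<exists>b\<ge>0. \<forall>y\<in>K. (\<integral>\<^sup>+\<omega>. ennreal (\<bar>frechet_derivative (\<lambda>y. u c y \<omega>) (at y) e\<bar> powr (1 + \<delta>)) \<partial>P) \<le> ennreal b"
proof -
  interpret random_C1_function P "cmap c ` cdom c" "u c" C
    by (rule random_C1_coordinate_payoff[OF c])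
  obtain \<delta> where \<delta>: "\<delta> > 0" "(SUP x\<in>cinv c ` K. flow_moment \<A> g P F \<xi> (1 + \<delta>) t x) < \<infinity>"
    using moment by blast
  define s where "s = (SUP x\<in>cinv c ` K. flow_moment \<A> g P F \<xi> (1 + \<delta>) t x)"
  obtain D where D: "\<And>x v. v \<in> tangent_space \<A> x \<Longrightarrow> \<bar>differential \<A> f x v\<bar> \<le> D * tnorm g x v"
    using df unfolding bounded_one_form_def by blast
  obtain N where N: "N > 0" "\<And>y. y \<in> K \<Longrightarrow> tnorm g (cinv c y) (tvec_of \<A> c (cinv c y) e) \<le> N"
    by (rule tnorm_bounded_on_compact[OF riem c K, where e = e]) blast
  \<comment> \<open>\<open>N\<close> bounds the norm of the coordinate field. The constant
    \<open>D\<close> is not known to be positive, and |D| + 1 ensures k > 0, so that division by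
    \<open>k\<close> is possible.\<close>
  define k where "k = ((\<bar>D\<bar> + 1) * N) powr (1 + \<delta>)"
  have k: "k > 0" using N(1) by (simp add: k_def)
  have "(\<integral>\<^sup>+\<omega>. ennreal (\<bar>G y e \<omega>\<bar> powr (1 + \<delta>)) \<partial>P) \<le> ennreal (k * enn2real s)" if y: "y \<in> K" for y
  proof -
    define x where "x = cinv c y"
    define v where "v = tvec_of \<A> c x e"
    have xc: "x \<in> cdom c" "y = cmap c x"
      using y K(2) cmap_cinv[OF atlas c] cinv_in_cdom[OF atlas c] by (auto simp: x_def)
    have v: "v \<in> tangent_space \<A> x" "v c = e"
      using tvec_of_in_tangent_space[OF atlas c xc(1)] tvec_of_component[OF atlas c xc(1)] by (simp_all add: v_def)
    define opn where "opn \<omega> = tangent_opnorm \<A> g x (F t x \<omega>) (tangent_map \<A> (\<lambda>y. F t y \<omega>) x)" for \<omega>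
    \<comment> \<open>The integrand of \<^const>\<open>flow_moment\<close> is not known to be measurable, so the constant \<open>k\<close> has
      to be moved to the other side before integrating.\<close>
    have bound: "AE \<omega> in P. ennreal (\<bar>G y e \<omega>\<bar> powr (1 + \<delta>) / k) \<le>
        ennreal (opn \<omega> powr (1 + \<delta>)) * indicator {\<omega>. ennreal t < \<xi> x \<omega>} \<omega>"
      using flow_regular_at_AE[of x]
    proof eventually_elim
      case (elim \<omega>)
      then have W: "open (W \<omega>)" "Ck_map_on \<A> 1 (W \<omega>) (\<lambda>x. F t x \<omega>)" "x \<in> W \<omega>" by auto
      let ?Tv = "tangent_map \<A> (\<lambda>y. F t y \<omega>) x v"
      have Tv: "?Tv \<in> tangent_space \<A> (F t x \<omega>)"
        by (rule tangent_map_in_tangent_space[OF atlas W(2,1,3) v(1)])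
      have "\<bar>G y e \<omega>\<bar> = \<bar>differential \<A> f (F t x \<omega>) ?Tv\<bar>"
        using frechet_derivative_coordinate_payoff[where F = F and t = t and \<omega> = \<omega> and \<xi> = \<xi>, OF atlas f W(1,2) c xc(1) W(3) v(1)] by (simp add: v(2) xc(2))
      also have "\<dots> \<le> (\<bar>D\<bar> + 1) * tnorm g (F t x \<omega>) ?Tv"
        by (rule order_trans[OF D[OF Tv]]) (intro mult_right_mono tnorm_nonneg[OF riem Tv], simp)
      finally have G1: "\<bar>G y e \<omega>\<bar> \<le> (\<bar>D\<bar> + 1) * tnorm g (F t x \<omega>) ?Tv" .
      have Tv_le: "tnorm g (F t x \<omega>) ?Tv \<le> opn \<omega> * tnorm g x v"
        unfolding opn_def by (rule tnorm_tangent_map_le[OF riem W(2,1,3) v(1)])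
      have "\<bar>G y e \<omega>\<bar> powr (1 + \<delta>) \<le> k * opn \<omega> powr (1 + \<delta>)"
      \<comment> \<open>That the operator norm is nonnegative is read off from 0 \<le> |TF v| \<le>
        |TF| |v|, which needs |v| > 0; if |v| = 0 the derivative itself vanishes.\<close>
      proof (cases "tnorm g x v = 0")
        case True
        then have "G y e \<omega> = 0"
          using G1 Tv_le tnorm_nonneg[OF riem Tv] by simp
        then show ?thesis using k by simp
      next
        case False
        then have "tnorm g x v > 0" using tnorm_nonneg[OF riem v(1)] by simp
        moreover have "0 \<le> opn \<omega> * tnorm g x v" using Tv_le tnorm_nonneg[OF riem Tv] by simp
        ultimately have opn: "opn \<omega> \<ge> 0" by (simp add: zero_le_mult_iff)
        have "tnorm g (F t x \<omega>) ?Tv \<le> opn \<omega> * N"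
          using Tv_le mult_left_mono[OF N(2)[OF y] opn] by (simp add: v_def x_def)
        then have "\<bar>G y e \<omega>\<bar> \<le> (\<bar>D\<bar> + 1) * (opn \<omega> * N)"
          by (intro order_trans[OF G1] mult_left_mono) auto
        also have "\<dots> = ((\<bar>D\<bar> + 1) * N) * opn \<omega>" by simp
        finally have "\<bar>G y e \<omega>\<bar> powr (1 + \<delta>) \<le> (((\<bar>D\<bar> + 1) * N) * opn \<omega>) powr (1 + \<delta>)"
          using \<delta>(1) by (intro powr_mono2) auto
        also have "\<dots> = k * opn \<omega> powr (1 + \<delta>)"
          using N(1) opn by (simp add: k_def powr_mult)
        finally show ?thesis .
      qed
      then have "\<bar>G y e \<omega>\<bar> powr (1 + \<delta>) / k \<le> opn \<omega> powr (1 + \<delta>)"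
        using k by (simp add: field_simps)
      then show ?case using W(3) by (auto simp: flow_domain_def intro: ennreal_leI)
    qed
    have [measurable]: "G y e \<in> borel_measurable P" using y K(2) by (intro G_measurable) auto
    have "(\<integral>\<^sup>+\<omega>. ennreal (\<bar>G y e \<omega>\<bar> powr (1 + \<delta>)) \<partial>P) =
        (\<integral>\<^sup>+\<omega>. ennreal k * ennreal (\<bar>G y e \<omega>\<bar> powr (1 + \<delta>) / k) \<partial>P)"
      using k by (intro nn_integral_cong) (simp add: ennreal_mult'[symmetric])
    also have "\<dots> = ennreal k * (\<integral>\<^sup>+\<omega>. ennreal (\<bar>G y e \<omega>\<bar> powr (1 + \<delta>) / k) \<partial>P)"
      by (rule nn_integral_cmult) measurable
    also have "\<dots> \<le> ennreal k * flow_moment \<A> g P F \<xi> (1 + \<delta>) t x"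
      unfolding flow_moment_def using bound unfolding opn_def by (intro mult_left_mono nn_integral_mono_AE) auto
    also have "\<dots> \<le> ennreal k * s"
      unfolding s_def using y by (intro mult_left_mono SUP_upper) (auto simp: x_def)
    also have "\<dots> = ennreal (k * enn2real s)"
      using \<delta>(2) k by (simp add: s_def[symmetric] ennreal_mult)
    finally show ?thesis .
  qed
  then show ?thesis using \<delta>(1) k by (intro exI[of _ \<delta>] conjI exI[of _ "k * enn2real s"]) auto
qed

text \<open>At time 0 the payoff is \<open>f\<close> itself on the flow domain. The flow must be the
  identity on a whole neighbourhood, for one \<omega>, before its derivative is known; this is what
  \<open>partial_flow_0\<close> provides.\<close>

lemma derivative_moment_time_0:
  assumes c: "c \<in> \<A>" and K: "compact K" "K \<subseteq> cmap c ` cdom c" and t0: "t = 0"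
  shows "\<exists>\<delta>>0. \<exists>b\<ge>0. \<forall>y\<in>K. (\<integral>\<^sup>+\<omega>. ennreal (\<bar>frechet_derivative (\<lambda>y. u c y \<omega>) (at y) e\<bar> powr (1 + \<delta>)) \<partial>P) \<le> ennreal b"
proof -
  interpret random_C1_function P "cmap c ` cdom c" "u c" C
    by (rule random_C1_coordinate_payoff[OF c])
  have fc: "Ck_on 1 (cmap c ` cdom c) (f \<circ> cinv c)" using f c unfolding Ck_fun_def by blast
  have "continuous_on K (\<lambda>y. frechet_derivative (f \<circ> cinv c) (at y) e)"
    using fc K(2) continuous_on_subset unfolding Ck_on_1 by blast
  then have "bounded ((\<lambda>y. frechet_derivative (f \<circ> cinv c) (at y) e) ` K)"
    using K(1) by (intro compact_imp_bounded compact_continuous_image)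
  then obtain N where N: "N > 0" "\<And>y. y \<in> K \<Longrightarrow> \<bar>frechet_derivative (f \<circ> cinv c) (at y) e\<bar> \<le> N"
    unfolding bounded_pos by fastforce
  have start: "AE \<omega> in P. F 0 x \<omega> = x" for x
    using sol[of x] by (simp add: sde_solution_def)
  \<comment> \<open>The derivative is bounded by a constant, so any exponent above 1 would do;
    \<delta> = 1 is chosen.\<close>
  have "(\<integral>\<^sup>+\<omega>. ennreal (\<bar>G y e \<omega>\<bar> powr (1 + 1)) \<partial>P) \<le> ennreal (N powr (1 + 1))" if y: "y \<in> K" for y
  proof -
    have yc: "cinv c y \<in> cdom c" "cmap c (cinv c y) = y"
      using y K(2) cmap_cinv[OF atlas c] cinv_in_cdom[OF atlas c] by auto
    have "AE \<omega> in P. ennreal (\<bar>G y e \<omega>\<bar> powr (1 + 1)) \<le> ennreal (N powr (1 + 1))"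
      using flow_regular_at_AE[of "cinv c y"] partial_flow_0[OF flow start]
    proof eventually_elim
      case (elim \<omega>)
      then have W: "open (W \<omega>)" "Ck_map_on \<A> 1 (W \<omega>) (\<lambda>x. F t x \<omega>)" "cinv c y \<in> W \<omega>"
        and id: "\<And>x. x \<in> W \<omega> \<Longrightarrow> F t x \<omega> = x" by (auto simp: t0)
      let ?V = "cmap c ` (cdom c \<inter> W \<omega>)"
      have yV: "y \<in> ?V" using yc W(3) by (metis IntI imageI)
      have "frechet_derivative (f \<circ> cinv c) (at y) = frechet_derivative (\<lambda>y. u c y \<omega>) (at y)"
      proof (rule frechet_derivative_transform_within_open[OF _ open_payoff_domain[where F = F and t = t and \<omega> = \<omega> and \<xi> = \<xi>, OF atlas f W(1,2) c] yV])
        show "(f \<circ> cinv c) differentiable (at y)" using fc y K(2) unfolding Ck_on_1 by blast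
        show "(f \<circ> cinv c) z = u c z \<omega>" if "z \<in> ?V" for z
          using that cinv_cmap[OF atlas c] id coordinate_payoff_eq[where F = F and t = t and \<omega> = \<omega> and \<xi> = \<xi>, OF atlas f W(1,2) c that] by auto
      qed
      then have "\<bar>G y e \<omega>\<bar> \<le> N" using N(2)[OF y] by simp
      then show ?case by (intro ennreal_leI powr_mono2) auto
    qed
    then have "(\<integral>\<^sup>+\<omega>. ennreal (\<bar>G y e \<omega>\<bar> powr (1 + 1)) \<partial>P) \<le> (\<integral>\<^sup>+\<omega>. ennreal (N powr (1 + 1)) \<partial>P)"
      by (rule nn_integral_mono_AE)
    then show ?thesis by (simp add: emeasure_space_1)
  qed
  then show ?thesis by (intro exI[of _ 1] conjI exI[of _ "N powr (1 + 1)"]) auto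
qed

text \<open>In each chart the semigroup is the expectation of the coordinate payoff, so the locale
  applies chart by chart. \<open>delta_integrand\<close> equals \<open>G\<close> only almost surely;
  it inherits measurability and integrability from \<open>G\<close>.\<close>

lemma diffusion_semigroup_C1_differential:
  assumes df: "bounded_one_form \<A> g (differential \<A> f)"
    and moment: "\<And>K. t > 0 \<Longrightarrow> compact K \<Longrightarrow> \<exists>\<delta>>0. (SUP x\<in>K. flow_moment \<A> g P F \<xi> (1 + \<delta>) t x) < \<infinity>"
  shows "Ck_fun \<A> 1 (diffusion_semigroup P F \<xi> t f)"
    and "v \<in> tangent_space \<A> x \<Longrightarrow> integrable P (delta_integrand \<A> F \<xi> t (differential \<A> f) x v)"
    and "v \<in> tangent_space \<A> x \<Longrightarrow> differential \<A> (diffusion_semigroup P F \<xi> t f) x v =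
      delta_semigroup \<A> P F \<xi> t (differential \<A> f) x v"
proof -
  have R: "random_C1_function_with_moments P (cmap c ` cdom c) (u c) C" if c: "c \<in> \<A>" for c
  proof (intro random_C1_function_with_moments.intro random_C1_function_with_moments_axioms.intro
      random_C1_coordinate_payoff[OF c])
    fix K e assume K: "compact K" "K \<subseteq> cmap c ` cdom c"
    show "\<exists>\<delta>>0. \<exists>b\<ge>0. \<forall>y\<in>K. (\<integral>\<^sup>+\<omega>. ennreal (\<bar>frechet_derivative (\<lambda>y. u c y \<omega>) (at y) e\<bar> powr (1 + \<delta>)) \<partial>P) \<le> ennreal b"
    proof (cases "t = 0")
      case False
      have "compact (cinv c ` K)"
        using K continuous_on_subset[OF continuous_on_cinv[OF atlas c]] by (intro compact_continuous_image)
      then show ?thesis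
        using False t by (intro derivative_moment_pos_time[OF c K df] moment) auto
    qed (rule derivative_moment_time_0[OF c K])
  qed
  have semigroup: "diffusion_semigroup P F \<xi> t f \<circ> cinv c = (\<lambda>y. \<integral>\<omega>. u c y \<omega> \<partial>P)" for c
    by (simp add: diffusion_semigroup_def coordinate_payoff_def fun_eq_iff)
  show "Ck_fun \<A> 1 (diffusion_semigroup P F \<xi> t f)"
    unfolding Ck_fun_def semigroup using random_C1_function_with_moments.expectation_C1[OF R] by blast
  assume v: "v \<in> tangent_space \<A> x"
  define c where "c = chart_at \<A> x"
  have c: "c \<in> \<A>" "x \<in> cdom c" using chart_at_in[OF atlas] by (auto simp: c_def)
  interpret random_C1_function_with_moments P "cmap c ` cdom c" "u c" C by (rule R[OF c(1)])
  have xS: "cmap c x \<in> cmap c ` cdom c" using c by auto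
  have eq: "AE \<omega> in P. G (cmap c x) (v c) \<omega> = delta_integrand \<A> F \<xi> t (differential \<A> f) x v \<omega>"
    using flow_regular_at_AE[of x]
  proof eventually_elim
    case (elim \<omega>)
    then show ?case
      using frechet_derivative_coordinate_payoff[where F = F and t = t and \<omega> = \<omega> and \<xi> = \<xi>, OF atlas f _ _ c _ v]
      by (auto simp: delta_integrand_def flow_domain_def)
  qed
  have meas: "delta_integrand \<A> F \<xi> t (differential \<A> f) x v \<in> borel_measurable P"
    by (rule borel_measurable_AE_eq[OF G_measurable[OF xS] eq])
  show "integrable P (delta_integrand \<A> F \<xi> t (differential \<A> f) x v)"
    by (rule integrable_cong_AE[THEN iffD1, OF G_measurable[OF xS] meas eq G_integrable[OF xS]])
  have "differential \<A> (diffusion_semigroup P F \<xi> t f) x v =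
      frechet_derivative (\<lambda>y. \<integral>\<omega>. u c y \<omega> \<partial>P) (at (cmap c x)) (v c)"
    by (simp add: differential_def Let_def semigroup[symmetric] flip: c_def)
  also have "\<dots> = expectation (G (cmap c x) (v c))"
    using frechet_derivative_at[OF expectation_has_derivative[OF xS]] by metis
  also have "\<dots> = delta_semigroup \<A> P F \<xi> t (differential \<A> f) x v"
    unfolding delta_semigroup_def by (rule integral_cong_AE[OF G_measurable[OF xS] meas eq])
  finally show "differential \<A> (diffusion_semigroup P F \<xi> t f) x v =
      delta_semigroup \<A> P F \<xi> t (differential \<A> f) x v" .
qed

end

theorem theorem6p3p1:
  fixes \<A> :: "('m::{second_countable_topology,t2_space}, 'e::euclidean_space) chart set"
    and g :: "'m \<Rightarrow> ('m, 'e) tvec \<Rightarrow> ('m, 'e) tvec \<Rightarrow> real"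
    and P :: "'w measure" and \<F> :: "ennreal \<Rightarrow> 'w measure"
    and B :: "real \<Rightarrow> 'w \<Rightarrow> 'b::euclidean_space"
    and X :: "'m \<Rightarrow> 'b \<Rightarrow> ('m, 'e) tvec" and A :: "'m \<Rightarrow> ('m, 'e) tvec"
    and F :: "real \<Rightarrow> 'm \<Rightarrow> 'w \<Rightarrow> 'm" and \<xi> :: "'m \<Rightarrow> 'w \<Rightarrow> ennreal"
    and f :: "'m \<Rightarrow> real" and t :: real
  assumes "riemannian_manifold \<A> g"
    and "usual_filtered_space P \<F>"
    and "brownian_motion P \<F> B"
    and "\<And>x c. linear (\<lambda>e. X x e c)"
    and "\<And>e. Ck_vector_field \<A> 2 (\<lambda>x. X x e)"
    and "Ck_vector_field \<A> 2 A"
    and "\<And>x. maximal_solution \<A> P \<F> B X A x (\<lambda>s. F s x) (\<xi> x)"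
    and "partial_flow \<A> P F \<xi>"
    and "strongly_1_complete \<A> P \<xi>"
    and "\<And>s K. s > 0 \<Longrightarrow> compact K \<Longrightarrow>
           \<exists>\<delta>>0. (SUP x\<in>K. flow_moment \<A> g P F \<xi> (1 + \<delta>) s x) < \<infinity>"
    and "Ck_fun \<A> 1 f"
    and "bounded (range f)"
    and "bounded_one_form \<A> g (differential \<A> f)"
    and "t \<ge> 0"
  shows "Ck_fun \<A> 1 (diffusion_semigroup P F \<xi> t f) \<and>
    (\<forall>x. \<forall>v\<in>tangent_space \<A> x.
       integrable P (delta_integrand \<A> F \<xi> t (differential \<A> f) x v) \<and>
       differential \<A> (diffusion_semigroup P F \<xi> t f) x v =
         delta_semigroup \<A> P F \<xi> t (differential \<A> f) x v)"
proof -
  obtain C where C: "\<And>x. \<bar>f x\<bar> \<le> C"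
    using \<open>bounded (range f)\<close> by (auto simp: bounded_iff)
  have sol: "sde_solution \<A> P \<F> B X A x (\<lambda>s. F s x) (\<xi> x)" for x
    using assms(7)[of x] by (simp add: maximal_solution_def)
  note main = diffusion_semigroup_C1_differential[OF assms(1,2) sol assms(8,9,11) C assms(14,13) assms(10)]
  show ?thesis using main by blast
qed

end
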